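(* Let $\lambda_1,\lambda_2>0$ and suppose that $\dim_{\mathrm H}\nu_{\lambda_1}+\dim_{\mathrm H}\nu_{\lambda_2}<1$, where $\nu_\lambda$ is the density of states measure of the Fibonacci Hamiltonian with coupling constant $\lambda$. Then the density of states measure $\nu_{\lambda_1,\lambda_2}$ of the square Fibonacci Hamiltonian with coupling constants $\lambda_1,\lambda_2$ is singular, that is, it is supported by a set of zero Lebesgue measure.
   Context: $\mathbb{T}=\mathbb{R}/\mathbb{Z}$ and $\alpha=\frac{\sqrt5-1}{2}$. The (standard) Fibonacci Hamiltonian with coupling constant $\lambda>0$ and phase $\omega\in\mathbb{T}$ is the bounded self-adjoint operator in $\ell^2(\mathbb{Z})$ $$[H^{(1)}_{\lambda,\omega}\psi](n)=\psi(n+1)+\psi(n-1)+\lambda\,\chi_{[1-\alpha,1)}(n\alpha+\omega \bmod 1)\,\psi(n).$$ The square Fibonacci Hamiltonian with coupling constants $\lambda_1,\lambda_2>0$ and phases $\omega_1,\omega_2\in\mathbb{T}$ is the bounded self-adjoint operator in $\ell^2(\mathbb{Z}^2)$ $$[H^{(2)}_{\lambda_1,\lambda_2,\omega_1,\omega_2}\psi](m,n)=\psi(m+1,n)+\psi(m-1,n)+\psi(m,n+1)+\psi(m,n-1)+\Big(\lambda_1\chi_{[1-\alpha,1)}(m\alpha+\omega_1 \bmod 1)+\lambda_2\chi_{[1-\alpha,1)}(n\alpha+\omega_2 \bmod 1)\Big)\psi(m,n).$$ The density of states measures $\nu_\lambda$ and $\nu_{\lambda_1,\lambda_2}$ are the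 Borel probability measures on $\mathbb{R}$ defined by $$\int_{\mathbb{R}} g(E)\,d\nu_\lambda(E)=\int_{\mathbb{T}}\langle\delta_0,g(H^{(1)}_{\lambda,\omega})\delta_0\rangle_{\ell^2(\mathbb{Z})}\,d\omega,$$ $$\int_{\mathbb{R}} g(E)\,d\nu_{\lambda_1,\lambda_2}(E)=\int_{\mathbb{T}}\int_{\mathbb{T}}\langle\delta_0,g(H^{(2)}_{\lambda_1,\lambda_2,\omega_1,\omega_2})\delta_0\rangle_{\ell^2(\mathbb{Z}^2)}\,d\omega_1\,d\omega_2.$$ A finite Borel measure $\mu$ on $\mathbb{R}$ is exact-dimensional with dimension $\dim\mu$ if $\lim_{\varepsilon\to0}\frac{\log\mu(B(x,\varepsilon))}{\log\varepsilon}=\dim\mu$ for $\mu$-almost every $x$; then $\dim_{\mathrm H}\mu=\dim\mu$, which is also the common value of $\inf\{\dim_{\mathrm H}(S):\mu(S)>0\}$ and $\inf\{\dim_{\mathrm H}(S):\mu(\mathbb{R}\setminus S)=0\}$. It is known (from earlier work of Damanik, Gorodetski and Yessen) that $\nu_\lambda$ is exact-dimensional for every $\lambda>0$, and $\dim_{\mathrm H}\nu_\lambda$ denotes its dimension in this sense. *)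

theory Defs
  imports
    "HOL-Probability.Probability"
    "HOL-Computational_Algebra.Polynomial"
begin

typedef 'a l2 = "{f :: 'a \<Rightarrow> complex. (\<lambda>i. (cmod (f i))\<^sup>2) summable_on UNIV}"
  morphisms l2_nth Abs_l2
  by (rule exI[of _ "\<lambda>_. 0"]) simp

setup_lifting type_definition_l2

lemma l2_eqI: "(\<And>i. l2_nth x i = l2_nth y i) \<Longrightarrow> x = y"
  by transfer auto

lemma l2_nth_summable: "(\<lambda>i. (cmod (l2_nth x i))\<^sup>2) summable_on UNIV"
  using l2_nth by auto

lemma square_summable_add:
  assumes "(\<lambda>i. (cmod (f i))\<^sup>2) summable_on UNIV" "(\<lambda>i. (cmod (g i))\<^sup>2) summable_on UNIV"
  shows "(\<lambda>i. (cmod (f i + g i))\<^sup>2) summable_on UNIV"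
proof (rule summable_on_comparison_test)
  show "(\<lambda>i. 2 * ((cmod (f i))\<^sup>2 + (cmod (g i))\<^sup>2)) summable_on UNIV"
    by (intro summable_on_cmult_right summable_on_add assms)
  fix i
  have "(cmod (f i + g i))\<^sup>2 \<le> (cmod (f i) + cmod (g i))\<^sup>2"
    by (intro power_mono norm_triangle_ineq norm_ge_zero)
  also have "\<dots> \<le> 2 * ((cmod (f i))\<^sup>2 + (cmod (g i))\<^sup>2)"
    using sum_squares_bound[of "cmod (f i)" "cmod (g i)"] by (simp add: power2_sum)
  finally show "(cmod (f i + g i))\<^sup>2 \<le> 2 * ((cmod (f i))\<^sup>2 + (cmod (g i))\<^sup>2)" .
qed auto

lemma square_summable_mult:
  assumes "(\<lambda>i. (cmod (f i))\<^sup>2) summable_on UNIV" "\<And>i. cmod (v i) \<le> C"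
  shows "(\<lambda>i. (cmod (v i * f i))\<^sup>2) summable_on UNIV"
proof (rule summable_on_comparison_test)
  show "(\<lambda>i. C\<^sup>2 * (cmod (f i))\<^sup>2) summable_on UNIV"
    by (intro summable_on_cmult_right assms)
  fix i
  show "(cmod (v i * f i))\<^sup>2 \<le> C\<^sup>2 * (cmod (f i))\<^sup>2"
    by (simp add: norm_mult power_mult_distrib mult_right_mono power_mono assms)
qed auto

lemma square_summable_reindex:
  assumes "(\<lambda>i. (cmod (f i))\<^sup>2) summable_on UNIV" "bij \<pi>"
  shows "(\<lambda>i. (cmod (f (\<pi> i)))\<^sup>2) summable_on UNIV"
  using summable_on_reindex_bij_betw[OF assms(2), of "\<lambda>i. (cmod (f i))\<^sup>2"] assms(1) by simp

definition l2_cinner :: "'a l2 \<Rightarrow> 'a l2 \<Rightarrow> complex" where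
  "l2_cinner x y = (\<Sum>\<^sub>\<infinity>i. cnj (l2_nth x i) * l2_nth y i)"

lemma l2_cinner_summable: "(\<lambda>i. cnj (l2_nth x i) * l2_nth y i) summable_on UNIV"
proof -
  have "(\<lambda>i. norm (cnj (l2_nth x i) * l2_nth y i)) summable_on UNIV"
  proof (rule summable_on_comparison_test)
    show "(\<lambda>i. (cmod (l2_nth x i))\<^sup>2 + (cmod (l2_nth y i))\<^sup>2) summable_on UNIV"
      by (intro summable_on_add l2_nth_summable)
    fix i
    have "2 * (cmod (l2_nth x i) * cmod (l2_nth y i)) \<le> (cmod (l2_nth x i))\<^sup>2 + (cmod (l2_nth y i))\<^sup>2"
      using sum_squares_bound[of "cmod (l2_nth x i)" "cmod (l2_nth y i)"] by simp
    moreover have "0 \<le> cmod (l2_nth x i) * cmod (l2_nth y i)" by simp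
    ultimately show "norm (cnj (l2_nth x i) * l2_nth y i) \<le> (cmod (l2_nth x i))\<^sup>2 + (cmod (l2_nth y i))\<^sup>2"
      unfolding norm_mult complex_mod_cnj by linarith
  qed auto
  then show ?thesis by (rule abs_summable_summable)
qed

instantiation l2 :: (type) real_inner
begin

lift_definition zero_l2 :: "'a l2" is "\<lambda>_. 0" by simp

lift_definition plus_l2 :: "'a l2 \<Rightarrow> 'a l2 \<Rightarrow> 'a l2" is "\<lambda>f g i. f i + g i"
  by (rule square_summable_add)

lift_definition uminus_l2 :: "'a l2 \<Rightarrow> 'a l2" is "\<lambda>f i. - f i" by simp

lift_definition minus_l2 :: "'a l2 \<Rightarrow> 'a l2 \<Rightarrow> 'a l2" is "\<lambda>f g i. f i - g i"
  using square_summable_add[of _ "\<lambda>i. - _ i"] by simp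

lift_definition scaleR_l2 :: "real \<Rightarrow> 'a l2 \<Rightarrow> 'a l2" is "\<lambda>r f i. complex_of_real r * f i"
  by (rule square_summable_mult) auto

definition inner_l2 :: "'a l2 \<Rightarrow> 'a l2 \<Rightarrow> real" where
  "inner_l2 x y = Re (l2_cinner x y)"

definition norm_l2 :: "'a l2 \<Rightarrow> real" where
  "norm_l2 x = sqrt (\<Sum>\<^sub>\<infinity>i. (cmod (l2_nth x i))\<^sup>2)"

definition dist_l2 :: "'a l2 \<Rightarrow> 'a l2 \<Rightarrow> real" where
  "dist_l2 x y = norm (x - y)"

definition sgn_l2 :: "'a l2 \<Rightarrow> 'a l2" where
  "sgn_l2 x = inverse (norm x) *\<^sub>R x"

definition uniformity_l2 :: "('a l2 \<times> 'a l2) filter" where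
  "uniformity_l2 = (INF e\<in>{0 <..}. principal {(x, y). dist x y < e})"

definition open_l2 :: "'a l2 set \<Rightarrow> bool" where
  "open_l2 U = (\<forall>x\<in>U. eventually (\<lambda>(x', y). x' = x \<longrightarrow> y \<in> U) uniformity)"

instance
proof
  fix x y z :: "'a l2" and r s :: real
  show "dist x y = norm (x - y)" by (rule dist_l2_def)
  show "sgn x = inverse (norm x) *\<^sub>R x" by (rule sgn_l2_def)
  show "(uniformity :: ('a l2 \<times> 'a l2) filter) = (INF e\<in>{0 <..}. principal {(x, y). dist x y < e})"
    by (rule uniformity_l2_def)
  show "open U = (\<forall>x\<in>U. \<forall>\<^sub>F (x', y) in uniformity. x' = x \<longrightarrow> y \<in> U)" for U :: "'a l2 set"
    by (rule open_l2_def)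
  show "x + y + z = x + (y + z)" by transfer (simp add: add.assoc)
  show "x + y = y + x" by transfer (simp add: add.commute)
  show "0 + x = x" by transfer simp
  show "- x + x = 0" by transfer simp
  show "x - y = x + - y" by transfer simp
  show "r *\<^sub>R (x + y) = r *\<^sub>R x + r *\<^sub>R y" by transfer (simp add: distrib_left)
  show "(r + s) *\<^sub>R x = r *\<^sub>R x + s *\<^sub>R x" by transfer (simp add: distrib_right)
  show "r *\<^sub>R s *\<^sub>R x = (r * s) *\<^sub>R x" by transfer (simp add: mult.assoc)
  show "1 *\<^sub>R x = x" by transfer simp
  have *: "inner x y = (\<Sum>\<^sub>\<infinity>i. Re (cnj (l2_nth x i) * l2_nth y i))" for x y :: "'a l2"
    unfolding inner_l2_def l2_cinner_def by (rule infsum_Re[symmetric, OF l2_cinner_summable])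
  have smb: "(\<lambda>i. Re (cnj (l2_nth x i) * l2_nth y i)) summable_on UNIV" for x y :: "'a l2"
    by (rule summable_on_Re[OF l2_cinner_summable])
  show "inner x y = inner y x"
    unfolding * by (rule infsum_cong) (simp add: mult.commute)
  show "inner (x + y) z = inner x z + inner y z"
    unfolding * infsum_add[OF smb smb, symmetric]
    by (rule infsum_cong) (simp add: plus_l2.rep_eq algebra_simps)
  show "inner (r *\<^sub>R x) y = r * inner x y"
    unfolding * infsum_cmult_right'[symmetric]
    by (rule infsum_cong) (simp add: scaleR_l2.rep_eq algebra_simps)
  have self: "inner x x = (\<Sum>\<^sub>\<infinity>i. (cmod (l2_nth x i))\<^sup>2)" for x :: "'a l2"
    unfolding * by (rule infsum_cong) (simp add: cmod_power2 flip: power2_eq_square)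
  show "0 \<le> inner x x"
    unfolding self by (rule infsum_nonneg) simp
  show "inner x x = 0 \<longleftrightarrow> x = 0"
  proof
    assume "inner x x = 0"
    then have "(\<Sum>\<^sub>\<infinity>i. (cmod (l2_nth x i))\<^sup>2) \<le> 0" by (simp add: self)
    then have "(cmod (l2_nth x i))\<^sup>2 = 0" for i
      by (rule nonneg_infsum_le_0D) (auto intro: l2_nth_summable)
    then show "x = 0" by (intro l2_eqI) (simp add: zero_l2.rep_eq)
  qed (simp add: self zero_l2.rep_eq)
  show "norm x = sqrt (inner x x)"
    unfolding self norm_l2_def ..
qed

end

lift_definition l2_delta :: "'a \<Rightarrow> 'a l2" is "\<lambda>j i. if i = j then 1 else 0"
proof -
  fix j :: 'a
  show "(\<lambda>i. (cmod (if i = j then 1 else 0))\<^sup>2) summable_on UNIV"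
    by (rule finite_nonzero_values_imp_summable_on) (auto intro: finite_subset[of _ "{j}"])
qed

definition blinfun_power :: "('v \<Rightarrow>\<^sub>L 'v) \<Rightarrow> nat \<Rightarrow> ('v :: real_normed_vector) \<Rightarrow>\<^sub>L 'v" where
  "blinfun_power A n = ((\<lambda>T. A o\<^sub>L T) ^^ n) id_blinfun"

definition poly_blinfun :: "real poly \<Rightarrow> ('v \<Rightarrow>\<^sub>L 'v) \<Rightarrow> ('v :: real_normed_vector) \<Rightarrow>\<^sub>L 'v" where
  "poly_blinfun p A = (\<Sum>k\<le>degree p. coeff p k *\<^sub>R blinfun_power A k)"

text \<open>
  Only real spectral parameters are considered: the spectrum of a self-adjoint operator is a
  subset of the real line. Blinfuns are merely real-linear, but if \<open>A\<close> is complex-linear, then so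
  is the inverse of \<open>A - E\<close>.
\<close>
definition real_spectrum :: "(('v :: real_normed_vector) \<Rightarrow>\<^sub>L 'v) \<Rightarrow> real set" where
  "real_spectrum A = {E. \<not> (\<exists>R. R o\<^sub>L (A - E *\<^sub>R id_blinfun) = id_blinfun \<and>
                               (A - E *\<^sub>R id_blinfun) o\<^sub>L R = id_blinfun)}"

text \<open>
  For continuous \<open>g\<close>, the operator \<open>g(A)\<close> is the limit in operator norm of \<open>p\<^sub>n(A)\<close>, for any real
  polynomials \<open>p\<^sub>n\<close> that converge to \<open>g\<close> uniformly on the spectrum of \<open>A\<close>.
\<close>
definition cont_calculus :: "(real \<Rightarrow> real) \<Rightarrow> ('v \<Rightarrow>\<^sub>L 'v) \<Rightarrow> ('v :: real_normed_vector) \<Rightarrow>\<^sub>L 'v" where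
  "cont_calculus g A = (THE T. \<forall>p :: nat \<Rightarrow> real poly.
     uniform_limit (real_spectrum A) (\<lambda>n. poly (p n)) g sequentially \<longrightarrow>
     (\<lambda>n. poly_blinfun (p n) A) \<longlonglongrightarrow> T)"

definition fib_alpha :: real where
  "fib_alpha = (sqrt 5 - 1) / 2"

definition fib_potential :: "real \<Rightarrow> int \<Rightarrow> real" where
  "fib_potential \<omega> n = indicator {1 - fib_alpha..<1} (frac (of_int n * fib_alpha + \<omega>))"

text \<open>
  Only meaningful if \<open>A\<close> maps square-summable families to square-summable families and is bounded
  and linear there. For the two Hamiltonians this is established by \<open>fib_hamiltonian_apply\<close> and
  \<open>square_fib_hamiltonian_apply\<close> below.
\<close>
definition l2_operator :: "(('a \<Rightarrow> complex) \<Rightarrow> 'a \<Rightarrow> complex) \<Rightarrow> 'a l2 \<Rightarrow>\<^sub>L 'a l2" where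
  "l2_operator A = Blinfun (\<lambda>\<psi>. Abs_l2 (A (l2_nth \<psi>)))"

definition fib_hamiltonian :: "real \<Rightarrow> real \<Rightarrow> int l2 \<Rightarrow>\<^sub>L int l2" where
  "fib_hamiltonian lam \<omega> = l2_operator (\<lambda>\<psi> n.
     \<psi> (n + 1) + \<psi> (n - 1) + complex_of_real (lam * fib_potential \<omega> n) * \<psi> n)"

definition square_fib_hamiltonian ::
    "real \<Rightarrow> real \<Rightarrow> real \<Rightarrow> real \<Rightarrow> (int \<times> int) l2 \<Rightarrow>\<^sub>L (int \<times> int) l2" where
  "square_fib_hamiltonian lam1 lam2 \<omega>1 \<omega>2 = l2_operator (\<lambda>\<psi> (m, n).
     \<psi> (m + 1, n) + \<psi> (m - 1, n) + \<psi> (m, n + 1) + \<psi> (m, n - 1)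
     + complex_of_real (lam1 * fib_potential \<omega>1 m + lam2 * fib_potential \<omega>2 n) * \<psi> (m, n))"

lemma bounded_linear_l2_mult:
  assumes "\<And>i. cmod (v i) \<le> C"
  shows "bounded_linear (\<lambda>\<psi>. Abs_l2 (\<lambda>i. v i * l2_nth \<psi> i))" (is "bounded_linear ?T")
    and "l2_nth (Abs_l2 (\<lambda>i. v i * l2_nth \<psi> i)) = (\<lambda>i. v i * l2_nth \<psi> i)"
proof -
  have nth: "l2_nth (Abs_l2 (\<lambda>i. v i * l2_nth \<psi> i)) = (\<lambda>i. v i * l2_nth \<psi> i)" for \<psi>
    by (rule Abs_l2_inverse) (auto intro: square_summable_mult[OF l2_nth_summable assms])
  have C: "0 \<le> C" using assms[of undefined] norm_ge_zero order_trans by blast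
  show "bounded_linear (\<lambda>\<psi>. Abs_l2 (\<lambda>i. v i * l2_nth \<psi> i))"
  proof (rule bounded_linear_intro[where K = C])
    fix x :: "'a l2"
    have "norm (Abs_l2 (\<lambda>i. v i * l2_nth x i)) = sqrt (\<Sum>\<^sub>\<infinity>i. (cmod (v i * l2_nth x i))\<^sup>2)"
      unfolding norm_l2_def nth ..
    also have "\<dots> \<le> sqrt (\<Sum>\<^sub>\<infinity>i. C\<^sup>2 * (cmod (l2_nth x i))\<^sup>2)"
      by (intro real_sqrt_le_mono infsum_mono summable_on_cmult_right l2_nth_summable
          square_summable_mult[OF l2_nth_summable assms])
        (simp add: norm_mult power_mult_distrib mult_right_mono power_mono assms)
    also have "\<dots> = norm x * C"
      unfolding infsum_cmult_right' norm_l2_def using C by (simp add: real_sqrt_mult)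
    finally show "norm (Abs_l2 (\<lambda>i. v i * l2_nth x i)) \<le> norm x * C" .
  next
    fix x y :: "'a l2" and r :: real
    show "?T (x + y) = ?T x + ?T y"
      by (rule l2_eqI) (subst nth plus_l2.rep_eq, simp only: nth plus_l2.rep_eq distrib_left)
    show "?T (r *\<^sub>R x) = r *\<^sub>R ?T x"
      by (rule l2_eqI) (subst nth scaleR_l2.rep_eq, simp only: nth scaleR_l2.rep_eq mult.left_commute)
  qed
  show "l2_nth (Abs_l2 (\<lambda>i. v i * l2_nth \<psi> i)) = (\<lambda>i. v i * l2_nth \<psi> i)" by (rule nth)
qed

lemma bounded_linear_l2_reindex:
  fixes \<pi> :: "'a \<Rightarrow> 'a"
  assumes "bij \<pi>"
  shows "bounded_linear (\<lambda>\<psi>. Abs_l2 (\<lambda>i. l2_nth \<psi> (\<pi> i)))" (is "bounded_linear ?T")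
    and "l2_nth (Abs_l2 (\<lambda>i. l2_nth \<psi> (\<pi> i))) = (\<lambda>i. l2_nth \<psi> (\<pi> i))"
proof -
  have nth: "l2_nth (Abs_l2 (\<lambda>i. l2_nth \<psi> (\<pi> i))) = (\<lambda>i. l2_nth \<psi> (\<pi> i))" for \<psi>
    by (rule Abs_l2_inverse) (auto intro: square_summable_reindex[OF l2_nth_summable assms])
  show "bounded_linear (\<lambda>\<psi>. Abs_l2 (\<lambda>i. l2_nth \<psi> (\<pi> i)))"
  proof (rule bounded_linear_intro[where K = 1])
    fix x :: "'a l2"
    show "norm (Abs_l2 (\<lambda>i. l2_nth x (\<pi> i))) \<le> norm x * 1"
      unfolding norm_l2_def nth
      using infsum_reindex_bij_betw[OF assms, of "\<lambda>i. (cmod (l2_nth x i))\<^sup>2"] by simp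
  next
    fix x y :: "'a l2" and r :: real
    show "?T (x + y) = ?T x + ?T y"
      by (rule l2_eqI) (subst nth plus_l2.rep_eq, simp only: nth plus_l2.rep_eq distrib_left)
    show "?T (r *\<^sub>R x) = r *\<^sub>R ?T x"
      by (rule l2_eqI) (subst nth scaleR_l2.rep_eq, simp only: nth scaleR_l2.rep_eq mult.left_commute)
  qed
  show "l2_nth (Abs_l2 (\<lambda>i. l2_nth \<psi> (\<pi> i))) = (\<lambda>i. l2_nth \<psi> (\<pi> i))" by (rule nth)
qed

lemma l2_operator_apply:
  assumes "bounded_linear T" "\<And>\<psi>. l2_nth (T \<psi>) = A (l2_nth \<psi>)"
  shows "l2_nth (blinfun_apply (l2_operator A) \<psi>) = A (l2_nth \<psi>)"
proof -
  have "Abs_l2 (A (l2_nth \<psi>)) = T \<psi>" for \<psi>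
    using assms(2)[of \<psi>] by (metis l2_nth_inverse)
  then show ?thesis
    unfolding l2_operator_def by (simp add: bounded_linear_Blinfun_apply assms)
qed

lemma fib_potential_bounds: "0 \<le> fib_potential \<omega> n" "fib_potential \<omega> n \<le> 1"
  by (auto simp: fib_potential_def indicator_def)

lemma fib_hamiltonian_apply:
  "l2_nth (blinfun_apply (fib_hamiltonian lam \<omega>) \<psi>) n =
     l2_nth \<psi> (n + 1) + l2_nth \<psi> (n - 1)
     + complex_of_real (lam * fib_potential \<omega> n) * l2_nth \<psi> n"
proof -
  have 1: "bij (\<lambda>n :: int. n + 1)" "bij (\<lambda>n :: int. n - 1)"
    by (rule bij_betw_byWitness[where f' = "\<lambda>n. n - 1"]; auto)
       (rule bij_betw_byWitness[where f' = "\<lambda>n. n + 1"]; auto)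
  have 2: "cmod (complex_of_real (lam * fib_potential \<omega> n)) \<le> \<bar>lam\<bar>" for n
    using fib_potential_bounds[of \<omega> n] by (simp add: norm_mult abs_mult mult_left_le)
  let ?T = "\<lambda>\<psi> :: int l2. Abs_l2 (\<lambda>n. l2_nth \<psi> (n + 1)) + Abs_l2 (\<lambda>n. l2_nth \<psi> (n - 1))
     + Abs_l2 (\<lambda>n. complex_of_real (lam * fib_potential \<omega> n) * l2_nth \<psi> n)"
  have "bounded_linear ?T"
    by (intro bounded_linear_add bounded_linear_l2_reindex(1) 1
        bounded_linear_l2_mult(1)[where C = "\<bar>lam\<bar>"] 2)
  moreover have "l2_nth (?T \<psi>) = (\<lambda>n. l2_nth \<psi> (n + 1) + l2_nth \<psi> (n - 1)
     + complex_of_real (lam * fib_potential \<omega> n) * l2_nth \<psi> n)" for \<psi>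
    by (rule ext, unfold plus_l2.rep_eq bounded_linear_l2_mult(2)[OF 2]
        bounded_linear_l2_reindex(2)[OF 1(1)] bounded_linear_l2_reindex(2)[OF 1(2)]) simp
  ultimately show ?thesis
    unfolding fib_hamiltonian_def by (subst l2_operator_apply) auto
qed

lemma square_fib_hamiltonian_apply:
  "l2_nth (blinfun_apply (square_fib_hamiltonian lam1 lam2 \<omega>1 \<omega>2) \<psi>) (m, n) =
     l2_nth \<psi> (m + 1, n) + l2_nth \<psi> (m - 1, n) + l2_nth \<psi> (m, n + 1) + l2_nth \<psi> (m, n - 1)
     + complex_of_real (lam1 * fib_potential \<omega>1 m + lam2 * fib_potential \<omega>2 n) * l2_nth \<psi> (m, n)"
proof -
  define r l u d where
    "r = (\<lambda>(m :: int, n :: int). (m + 1, n))" and "l = (\<lambda>(m :: int, n :: int). (m - 1, n))" and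
    "u = (\<lambda>(m :: int, n :: int). (m, n + 1))" and "d = (\<lambda>(m :: int, n :: int). (m, n - 1))"
  note defs = r_def l_def u_def d_def
  have 1: "bij r" "bij l" "bij u" "bij d"
    by (rule o_bij[of l] o_bij[of r] o_bij[of d] o_bij[of u]; force simp: defs)+
  define v where
    "v = (\<lambda>(m, n). complex_of_real (lam1 * fib_potential \<omega>1 m + lam2 * fib_potential \<omega>2 n))"
  have 2: "cmod (v i) \<le> \<bar>lam1\<bar> + \<bar>lam2\<bar>" for i
  proof -
    obtain m n where i: "i = (m, n)" by (cases i)
    have "\<bar>lam1 * fib_potential \<omega>1 m\<bar> \<le> \<bar>lam1\<bar>" "\<bar>lam2 * fib_potential \<omega>2 n\<bar> \<le> \<bar>lam2\<bar>"
      using fib_potential_bounds by (simp_all add: abs_mult mult_left_le)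
    then show ?thesis
      unfolding i v_def prod.case norm_of_real by linarith
  qed
  let ?T = "\<lambda>\<psi>. Abs_l2 (\<lambda>i. l2_nth \<psi> (r i)) + Abs_l2 (\<lambda>i. l2_nth \<psi> (l i))
     + Abs_l2 (\<lambda>i. l2_nth \<psi> (u i)) + Abs_l2 (\<lambda>i. l2_nth \<psi> (d i))
     + Abs_l2 (\<lambda>i. v i * l2_nth \<psi> i)"
  have bl: "bounded_linear ?T"
    by (intro bounded_linear_add bounded_linear_l2_reindex(1) 1
        bounded_linear_l2_mult(1)[where C = "\<bar>lam1\<bar> + \<bar>lam2\<bar>"] 2)
  have "l2_nth (?T \<psi>) = (\<lambda>(m, n).
     l2_nth \<psi> (m + 1, n) + l2_nth \<psi> (m - 1, n) + l2_nth \<psi> (m, n + 1) + l2_nth \<psi> (m, n - 1)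
     + complex_of_real (lam1 * fib_potential \<omega>1 m + lam2 * fib_potential \<omega>2 n) * l2_nth \<psi> (m, n))" for \<psi>
    by (rule ext, unfold plus_l2.rep_eq bounded_linear_l2_mult(2)[OF 2]
        bounded_linear_l2_reindex(2)[OF 1(1)] bounded_linear_l2_reindex(2)[OF 1(2)]
        bounded_linear_l2_reindex(2)[OF 1(3)] bounded_linear_l2_reindex(2)[OF 1(4)])
       (auto simp: defs v_def)
  from l2_operator_apply[OF bl this] show ?thesis
    unfolding square_fib_hamiltonian_def by simp
qed

text \<open>
  The circle is represented by \<open>[0,1)\<close> with Lebesgue measure. The test functions \<open>g\<close> are the
  bounded continuous ones, which determine a Borel probability measure uniquely.
\<close>

definition fib_dos :: "real \<Rightarrow> real measure" where
  "fib_dos lam = (THE \<nu>. prob_space \<nu> \<and> sets \<nu> = sets borel \<and>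
     (\<forall>g :: real \<Rightarrow> real. continuous_on UNIV g \<longrightarrow> bounded (range g) \<longrightarrow>
        complex_of_real (\<integral>E. g E \<partial>\<nu>) =
        (LINT \<omega>:{0..<1}|lborel.
           l2_cinner (l2_delta 0) (blinfun_apply (cont_calculus g (fib_hamiltonian lam \<omega>)) (l2_delta 0)))))"

definition square_fib_dos :: "real \<Rightarrow> real \<Rightarrow> real measure" where
  "square_fib_dos lam1 lam2 = (THE \<nu>. prob_space \<nu> \<and> sets \<nu> = sets borel \<and>
     (\<forall>g :: real \<Rightarrow> real. continuous_on UNIV g \<longrightarrow> bounded (range g) \<longrightarrow>
        complex_of_real (\<integral>E. g E \<partial>\<nu>) =
        (LINT \<omega>1:{0..<1}|lborel. LINT \<omega>2:{0..<1}|lborel.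
           l2_cinner (l2_delta (0, 0))
             (blinfun_apply (cont_calculus g (square_fib_hamiltonian lam1 lam2 \<omega>1 \<omega>2)) (l2_delta (0, 0))))))"

text \<open>
  This is a relation between a measure and its dimension, so that it asserts both that the
  dimension is defined and that it equals \<open>d\<close>. (For \<open>\<mu> \<noteq> 0\<close> there is at most one such \<open>d\<close>.)
\<close>
definition exact_dimensional :: "real measure \<Rightarrow> real \<Rightarrow> bool" where
  "exact_dimensional \<mu> d \<longleftrightarrow> finite_measure \<mu> \<and> sets \<mu> = sets borel \<and>
     (AE x in \<mu>. ((\<lambda>\<epsilon>. ln (measure \<mu> (ball x \<epsilon>)) / ln \<epsilon>) \<longlongrightarrow> d) (at_right 0))"

end

theory Submission
  imports Defs "HOL-Computational_Algebra.Fundamental_Theorem_Algebra"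
begin

text \<open>
  Expanding \<open>(A \<otimes> 1 + 1 \<otimes> B)\<^sup>n\<close> binomially shows that the density of states measure of the square
  Hamiltonian has the moments of the convolution of the two one-dimensional ones, and is therefore
  equal to it. If \<open>\<mu>\<close> and \<open>\<nu>\<close> are exact-dimensional and \<open>s > dim \<mu>\<close>, \<open>t > dim \<nu>\<close>, \<open>s + t < 1\<close>, then
  almost all points lie in countably many sets on which all small \<open>\<epsilon>\<close>-balls have mass at least
  \<open>\<epsilon>\<^sup>s\<close> and \<open>\<epsilon>\<^sup>t\<close>, respectively. Such sets meet \<open>O(\<epsilon>\<^sup>-\<^sup>s)\<close> and \<open>O(\<epsilon>\<^sup>-\<^sup>t)\<close> cells of an \<open>\<epsilon>\<close>-grid, so their
  sumset is covered by intervals of total length \<open>O(\<epsilon>\<^bsup>1-s-t\<^esup>)\<close> and is a null set. The sumsets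
  carry the convolution.
\<close>

section \<open>The Hilbert space of square-summable families\<close>

text \<open>Both density of states measures and the functional calculus are definite descriptions,
  so existence and uniqueness must be settled before anything can be said about them. For the
  calculus this rests on the norm of \<open>p(A)\<close> being \<open>|p(r)|\<close> at some
  \<open>r\<close> in the real spectrum. It is proved by factoring polynomials; operators are only
  real-linear here, so non-real roots are absorbed in conjugate pairs with the help of
  self-adjointness. For the measures it rests on a representation theorem for positive functionals,
  with the measure built from a distribution function. Tensor products are avoided: the vectors
  \<open>H^k \<delta>\<close> are explicit real recursions, and the binomial sum is checked against
  the recursion of the square Hamiltonian. Since the operator norms are bounded independently of the
  phase, one polynomial approximates a test function for all phases at once, and this uniformity
  also yields measurability in the phase.\<close>

lemma norm_l2_power2: "(norm x)\<^sup>2 = (\<Sum>\<^sub>\<infinity>i. (cmod (l2_nth x i))\<^sup>2)"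
  unfolding norm_l2_def by (rule real_sqrt_pow2) (simp add: infsum_nonneg)

lemma sum_nth_le_norm_l2: "finite F \<Longrightarrow> (\<Sum>i\<in>F. (cmod (l2_nth x i))\<^sup>2) \<le> (norm x)\<^sup>2"
  unfolding norm_l2_power2 by (rule finite_sum_le_infsum) (auto intro: l2_nth_summable)

lemma cmod_nth_le_norm_l2: "cmod (l2_nth x i) \<le> norm x"
  using sum_nth_le_norm_l2[of "{i}" x] by (auto intro: power2_le_imp_le)

lemma tendsto_l2_nth:
  assumes "(f \<longlongrightarrow> x) F"
  shows "((\<lambda>n. l2_nth (f n) i) \<longlongrightarrow> l2_nth x i) F"
proof (rule Lim_null[THEN iffD2], rule Lim_null_comparison)
  show "\<forall>\<^sub>F n in F. norm (l2_nth (f n) i - l2_nth x i) \<le> norm (f n - x)"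
    using cmod_nth_le_norm_l2[of "f _ - x" i] by (simp add: minus_l2.rep_eq)
  show "((\<lambda>n. norm (f n - x)) \<longlongrightarrow> 0) F"
    using assms by (intro tendsto_norm_zero) (simp flip: Lim_null)
qed

text \<open>Completeness enters twice: for the convergence of Neumann series, and for the
  convergence of approximating polynomials of an operator. The limit is formed coordinatewise, and
  bounds on finite partial sums make it square summable.\<close>

instance l2 :: (type) banach
proof
  fix X :: "nat \<Rightarrow> 'a l2"
  assume X: "Cauchy X"
  have "Cauchy (\<lambda>n. l2_nth (X n) i)" for i
  proof (rule metric_CauchyI)
    fix e :: real assume "e > 0"
    then obtain N where N: "\<And>m n. m \<ge> N \<Longrightarrow> n \<ge> N \<Longrightarrow> dist (X m) (X n) < e"
      using metric_CauchyD[OF X] by blast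
    have "dist (l2_nth (X m) i) (l2_nth (X n) i) < e" if "m \<ge> N" "n \<ge> N" for m n
      using N[OF that] cmod_nth_le_norm_l2[of "X m - X n" i] by (simp add: dist_norm minus_l2.rep_eq)
    then show "\<exists>N. \<forall>m\<ge>N. \<forall>n\<ge>N. dist (l2_nth (X m) i) (l2_nth (X n) i) < e" by blast
  qed
  then have "\<exists>f. \<forall>i. (\<lambda>n. l2_nth (X n) i) \<longlonglongrightarrow> f i"
    by (intro choice) (simp add: Cauchy_convergent_iff convergent_def)
  then obtain f where f: "\<And>i. (\<lambda>n. l2_nth (X n) i) \<longlonglongrightarrow> f i" by blast
  obtain B where B: "\<And>n. norm (X n) \<le> B"
    using Cauchy_Bseq[OF X] unfolding Bseq_def by blast
  have "(\<Sum>i\<in>F. (cmod (f i))\<^sup>2) \<le> B\<^sup>2" if "finite F" for F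
  proof (rule LIMSEQ_le_const2)
    show "(\<lambda>n. \<Sum>i\<in>F. (cmod (l2_nth (X n) i))\<^sup>2) \<longlonglongrightarrow> (\<Sum>i\<in>F. (cmod (f i))\<^sup>2)"
      by (intro tendsto_intros f)
    have "(\<Sum>i\<in>F. (cmod (l2_nth (X n) i))\<^sup>2) \<le> B\<^sup>2" for n
      by (rule order_trans[OF sum_nth_le_norm_l2[OF that] power_mono[OF B norm_ge_zero]])
    then show "\<exists>N. \<forall>n\<ge>N. (\<Sum>i\<in>F. (cmod (l2_nth (X n) i))\<^sup>2) \<le> B\<^sup>2" by blast
  qed
  then have "(\<lambda>i. (cmod (f i))\<^sup>2) summable_on UNIV"
    by (intro nonneg_bdd_above_summable_on bdd_aboveI[of _ "B\<^sup>2"]) auto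
  then have nth: "l2_nth (Abs_l2 f) = f" by (simp add: Abs_l2_inverse)
  have "X \<longlonglongrightarrow> Abs_l2 f"
  proof (rule metric_LIMSEQ_I)
    fix r :: real assume "r > 0"
    then have "r / 2 > 0" by simp
    then obtain N where N: "\<And>m n. m \<ge> N \<Longrightarrow> n \<ge> N \<Longrightarrow> dist (X m) (X n) < r / 2"
      using metric_CauchyD[OF X] by blast
    have "dist (X n) (Abs_l2 f) < r" if n: "n \<ge> N" for n
    proof -
      \<comment> \<open>Here \<open>m\<close> tends to infinity inside each finite partial sum,
        before the infinite sum is taken. Strictness is lost in that limit, which the factor 1/2
        repairs.\<close>
      have "(norm (X n - Abs_l2 f))\<^sup>2 \<le> (r / 2)\<^sup>2"
        unfolding norm_l2_power2
      proof (rule infsum_le_finite_sums[OF l2_nth_summable])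
        fix F :: "'a set" assume F: "finite F"
        show "(\<Sum>i\<in>F. (cmod (l2_nth (X n - Abs_l2 f) i))\<^sup>2) \<le> (r / 2)\<^sup>2"
        proof (rule LIMSEQ_le_const2)
          show "(\<lambda>m. \<Sum>i\<in>F. (cmod (l2_nth (X n - X m) i))\<^sup>2)
             \<longlonglongrightarrow> (\<Sum>i\<in>F. (cmod (l2_nth (X n - Abs_l2 f) i))\<^sup>2)"
            unfolding minus_l2.rep_eq nth by (intro tendsto_intros f)
          have "(\<Sum>i\<in>F. (cmod (l2_nth (X n - X m) i))\<^sup>2) \<le> (r / 2)\<^sup>2" if "m \<ge> N" for m
            by (rule order_trans[OF sum_nth_le_norm_l2[OF F] power_mono[OF less_imp_le norm_ge_zero]])
              (use N[OF n that] in \<open>simp only: dist_norm\<close>)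
          then show "\<exists>N. \<forall>m\<ge>N. (\<Sum>i\<in>F. (cmod (l2_nth (X n - X m) i))\<^sup>2) \<le> (r / 2)\<^sup>2"
            by blast
        qed
      qed
      then have "norm (X n - Abs_l2 f) \<le> r / 2"
        using \<open>r > 0\<close> by (auto intro: power2_le_imp_le)
      then show ?thesis using \<open>r > 0\<close> by (simp add: dist_norm)
    qed
    then show "\<exists>no. \<forall>n\<ge>no. dist (X n) (Abs_l2 f) < r" by blast
  qed
  then show "convergent X" by (rule convergentI)
qed

section \<open>Polynomials of a self-adjoint operator\<close>

lemma blinfun_power_0 [simp]: "blinfun_power A 0 = id_blinfun"
  and blinfun_power_Suc [simp]: "blinfun_power A (Suc n) = A o\<^sub>L blinfun_power A n"
  by (simp_all add: blinfun_power_def)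

lemma poly_blinfun_eq_sum:
  assumes "degree p \<le> n"
  shows "poly_blinfun p A = (\<Sum>k\<le>n. coeff p k *\<^sub>R blinfun_power A k)"
  unfolding poly_blinfun_def using assms
  by (intro sum.mono_neutral_left) (auto simp: coeff_eq_0)

lemma poly_blinfun_0 [simp]: "poly_blinfun 0 A = 0"
  by (simp add: poly_blinfun_def)

lemma poly_blinfun_add: "poly_blinfun (p + q) A = poly_blinfun p A + poly_blinfun q A"
proof -
  let ?n = "max (degree p) (degree q)"
  have "degree (p + q) \<le> ?n" by (rule degree_add_le_max)
  then show ?thesis
    by (simp add: poly_blinfun_eq_sum[of _ ?n] scaleR_add_left sum.distrib)
qed

lemma poly_blinfun_smult: "poly_blinfun (smult c p) A = c *\<^sub>R poly_blinfun p A"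
  using degree_smult_le[of c p]
  by (simp add: poly_blinfun_eq_sum[of _ "degree p"] scaleR_sum_right)

lemma poly_blinfun_diff: "poly_blinfun (p - q) A = poly_blinfun p A - poly_blinfun q A"
  using poly_blinfun_add[of "p - q" q A] by simp

lemma poly_blinfun_pCons:
  "poly_blinfun (pCons a p) A = a *\<^sub>R id_blinfun + (A o\<^sub>L poly_blinfun p A)"
proof -
  interpret C: bounded_bilinear "(o\<^sub>L) :: ('a \<Rightarrow>\<^sub>L 'a) \<Rightarrow> _"
    by (rule bounded_bilinear_blinfun_compose)
  have "poly_blinfun (pCons a p) A
      = (\<Sum>k\<le>Suc (degree p). coeff (pCons a p) k *\<^sub>R blinfun_power A k)"
    by (rule poly_blinfun_eq_sum) (rule degree_pCons_le)
  also have "\<dots> = a *\<^sub>R id_blinfun + (A o\<^sub>L poly_blinfun p A)"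
    by (simp only: sum.atMost_Suc_shift) (simp add: poly_blinfun_def C.sum_right C.scaleR_right)
  finally show ?thesis .
qed

lemma poly_blinfun_const: "poly_blinfun [:c:] A = c *\<^sub>R id_blinfun"
  by (simp add: poly_blinfun_pCons)

lemma poly_blinfun_mult_apply:
  "poly_blinfun (p * q) A x = poly_blinfun p A (poly_blinfun q A x)"
  by (induction p)
     (simp_all add: poly_blinfun_add poly_blinfun_smult poly_blinfun_pCons blinfun.bilinear_simps)

section \<open>Self-adjointness and lower bounds for polynomials of an operator\<close>

definition selfadjoint :: "('v :: real_inner \<Rightarrow>\<^sub>L 'v) \<Rightarrow> bool" where
  "selfadjoint A \<longleftrightarrow> (\<forall>x y. A x \<bullet> y = x \<bullet> A y)"

lemma selfadjointD: "selfadjoint A \<Longrightarrow> A x \<bullet> y = x \<bullet> A y"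
  by (simp add: selfadjoint_def)

lemma selfadjoint_poly_blinfun:
  assumes A: "selfadjoint A"
  shows "selfadjoint (poly_blinfun p A)"
proof (induction p)
  case (pCons a p)
  \<comment> \<open>Both sides are the polynomial \<open>X * p\<close> in \<open>A\<close>, so
    commutativity of polynomial multiplication applies.\<close>
  have "poly_blinfun p A (A x) = A (poly_blinfun p A x)" for x
    using poly_blinfun_mult_apply[of p "[:0, 1:]" A x] poly_blinfun_mult_apply[of "[:0, 1:]" p A x]
    by (simp add: poly_blinfun_pCons mult.commute blinfun.bilinear_simps)
  then show ?case
    using pCons.IH by (simp add: selfadjoint_def poly_blinfun_pCons blinfun.bilinear_simps
        inner_left_distrib inner_right_distrib selfadjointD[OF A])
qed (simp add: selfadjoint_def)

text \<open>A one-sided substitute for invertibility: it passes to products of polynomials with no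
  inverse to construct, and every point outside the real spectrum provides it.\<close>

definition bounded_below :: "('v :: real_normed_vector \<Rightarrow>\<^sub>L 'v) \<Rightarrow> bool" where
  "bounded_below T \<longleftrightarrow> (\<exists>c>0. \<forall>x. c * norm x \<le> norm (T x))"

lemma bounded_belowI:
  fixes T :: "'v :: real_normed_vector \<Rightarrow>\<^sub>L 'v"
  assumes "c > 0" "\<And>x. c * norm x \<le> norm (T x)"
  shows "bounded_below T"
  using assms bounded_below_def by blast

lemma bounded_below_if_notin_real_spectrum:
  assumes "E \<notin> real_spectrum A"
  shows "bounded_below (A - E *\<^sub>R id_blinfun)"
proof -
  obtain R where R: "R o\<^sub>L (A - E *\<^sub>R id_blinfun) = id_blinfun"
    using assms by (auto simp: real_spectrum_def)
  show ?thesis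
  proof (rule bounded_belowI)
    \<comment> \<open>The summand 1 keeps the constant positive even if \<open>R = 0\<close>, as
      happens on the zero space.\<close>
    show "1 / (norm R + 1) > 0" by (simp add: add_nonneg_pos)
    fix x
    have "norm x = norm (R ((A - E *\<^sub>R id_blinfun) x))"
      using arg_cong[OF R, of "\<lambda>T. T x"] by simp
    also have "\<dots> \<le> norm R * norm ((A - E *\<^sub>R id_blinfun) x)" by (rule norm_blinfun)
    also have "\<dots> \<le> (norm R + 1) * norm ((A - E *\<^sub>R id_blinfun) x)"
      by (intro mult_right_mono) auto
    finally show "1 / (norm R + 1) * norm x \<le> norm ((A - E *\<^sub>R id_blinfun) x)"
      by (simp add: add_nonneg_pos pos_divide_le_eq mult.commute)
  qed
qed

lemma bounded_below_poly_blinfun_mult: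
  assumes "bounded_below (poly_blinfun p A)" "bounded_below (poly_blinfun q A)"
  shows "bounded_below (poly_blinfun (p * q) A)"
proof -
  obtain c d where c: "c > 0" "\<And>x. c * norm x \<le> norm (poly_blinfun p A x)"
    and d: "d > 0" "\<And>x. d * norm x \<le> norm (poly_blinfun q A x)"
    using assms unfolding bounded_below_def by blast
  show ?thesis
  proof (rule bounded_belowI)
    show "c * d > 0" using c d by simp
    fix x
    have "c * d * norm x \<le> c * norm (poly_blinfun q A x)"
      using c(1) d(2)[of x] by simp
    also have "\<dots> \<le> norm (poly_blinfun (p * q) A x)"
      unfolding poly_blinfun_mult_apply by (rule c(2))
    finally show "c * d * norm x \<le> norm (poly_blinfun (p * q) A x)" .
  qed
qed

text \<open>The polynomial is \<open>(t - a)^2 + b^2\<close>, so its quadratic form at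
  \<open>x\<close> is the squared norm of \<open>(A - a) x\<close> plus \<open>b^2\<close> times
  that of \<open>x\<close>; Cauchy-Schwarz finishes. This replaces the invertibility of
  \<open>A - z\<close> at a non-real \<open>z = a + i b\<close>.\<close>

lemma bounded_below_poly_blinfun_quadratic:
  fixes A :: "'v :: real_inner \<Rightarrow>\<^sub>L 'v"
  assumes A: "selfadjoint A" and b: "b \<noteq> 0"
  shows "bounded_below (poly_blinfun [:a\<^sup>2 + b\<^sup>2, -2 * a, 1:] A)"
proof (rule bounded_belowI)
  show "b\<^sup>2 > 0" using b by simp
  fix x
  let ?T = "poly_blinfun [:a\<^sup>2 + b\<^sup>2, -2 * a, 1:] A"
  have "b\<^sup>2 * (norm x)\<^sup>2 \<le> (norm (A x - a *\<^sub>R x))\<^sup>2 + b\<^sup>2 * (norm x)\<^sup>2" by simp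
  also have "\<dots> = ?T x \<bullet> x"
    unfolding power2_norm_eq_inner
    by (simp add: poly_blinfun_pCons blinfun.bilinear_simps inner_diff_left inner_diff_right
        inner_left_distrib selfadjointD[OF A, of "A x" x] inner_commute[of x "A x"] algebra_simps power2_eq_square)
  also have "\<dots> \<le> norm (?T x) * norm x" by (rule norm_cauchy_schwarz)
  finally show "b\<^sup>2 * norm x \<le> norm (?T x)"
    by (cases "x = 0") (simp_all add: power2_eq_square)
qed

text \<open>The divisor is \<open>(X - z)(X - cnj z)\<close>. The remainder \<open>u + v X\<close>
  has real coefficients and vanishes at the non-real point \<open>z\<close>, so it is 0.\<close>

lemma real_poly_quadratic_dvd:
  fixes q :: "real poly"
  assumes z: "poly (map_poly complex_of_real q) z = 0" and "Im z \<noteq> 0"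
  shows "[:(Re z)\<^sup>2 + (Im z)\<^sup>2, -2 * Re z, 1:] dvd q"
proof -
  let ?d = "[:(Re z)\<^sup>2 + (Im z)\<^sup>2, -2 * Re z, 1:]"
  define r where "r = q mod ?d"
  have q: "q = ?d * (q div ?d) + r" unfolding r_def by (simp only: mult_div_mod_eq)
  have "degree r < degree ?d \<or> r = 0"
    unfolding r_def using degree_mod_less[of ?d q] by auto
  then have "degree r \<le> 1" by auto
  then have "r = [:coeff r 0, coeff r 1:]"
    by (intro poly_eqI) (auto simp: coeff_pCons coeff_eq_0 split: nat.split)
  then obtain u v where r: "r = [:u, v:]" by blast
  have hom: "map_poly complex_of_real (f * g) = map_poly complex_of_real f * map_poly complex_of_real g"
    "map_poly complex_of_real (f + g) = map_poly complex_of_real f + map_poly complex_of_real g"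
    for f g by (simp_all add: poly_eq_iff coeff_map_poly coeff_mult)
  have "poly (map_poly complex_of_real ?d) z = 0"
    by (simp add: map_poly_pCons complex_eq_iff power2_eq_square algebra_simps)
  then have "poly (map_poly complex_of_real r) z = 0"
    using z by (subst (asm) q) (simp only: hom poly_add poly_mult mult_zero_left add_0)
  then have "of_real u + z * of_real v = 0"
    by (simp add: r map_poly_pCons)
  then have "v = 0" "u = 0"
    using assms(2) by (auto simp: complex_eq_iff)
  then show ?thesis using r unfolding r_def by (simp add: dvd_eq_mod_eq_0)
qed

text \<open>Induction on the degree, splitting off a linear factor at a real root, which lies
  outside the spectrum by assumption, or a quadratic factor at a conjugate pair. Read
  contrapositively, this is the half of the spectral mapping theorem that produces spectral
  points.\<close>

lemma bounded_below_poly_blinfun: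
  fixes A :: "'v :: real_inner \<Rightarrow>\<^sub>L 'v"
  assumes A: "selfadjoint A" and "q \<noteq> 0" "\<And>r. poly q r = 0 \<Longrightarrow> r \<notin> real_spectrum A"
  shows "bounded_below (poly_blinfun q A)"
  using assms(2,3)
proof (induction "degree q" arbitrary: q rule: less_induct)
  case (less q)
  show ?case
  proof (cases "degree q = 0")
    case True
    then obtain c where q: "q = [:c:]" by (rule degree_eq_zeroE)
    with less.prems have "\<bar>c\<bar> > 0" by simp
    then show ?thesis
      by (rule bounded_belowI) (simp add: q poly_blinfun_const blinfun.bilinear_simps)
  next
    case False
    let ?q = "map_poly complex_of_real q"
    have "degree ?q = degree q" by (rule degree_map_poly) simp
    then have "\<not> constant (poly ?q)" using False by (simp add: constant_degree)
    then obtain z where z: "poly ?q z = 0" using fundamental_theorem_of_algebra by blast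
    obtain d where d: "d dvd q" "degree d > 0" "bounded_below (poly_blinfun d A)"
    proof (cases "Im z = 0")
      case True
      then have z': "z = of_real (Re z)" by (simp add: complex_eq_iff)
      have "poly ?q (of_real x) = of_real (poly q x)" for x
        by (induction q) (simp_all add: map_poly_pCons)
      then have root: "poly q (Re z) = 0" using z by (subst (asm) z') simp
      have "poly_blinfun [:- Re z, 1:] A = A - Re z *\<^sub>R id_blinfun"
        by (rule blinfun_eqI) (simp add: poly_blinfun_pCons blinfun.bilinear_simps)
      then have "bounded_below (poly_blinfun [:- Re z, 1:] A)"
        using bounded_below_if_notin_real_spectrum[OF less.prems(2)[OF root]] by simp
      then show thesis using that[of "[:- Re z, 1:]"] root by (simp add: poly_eq_0_iff_dvd)
    next
      case False
      then show thesis
        by (intro that[OF real_poly_quadratic_dvd[OF z False]])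
           (use bounded_below_poly_blinfun_quadratic[OF A False] in auto)
    qed
    then obtain q' where q': "q = d * q'" by (elim dvdE)
    have "degree q = degree d + degree q'"
      using less.prems(1) q' by (simp add: degree_mult_eq)
    then have "bounded_below (poly_blinfun q' A)"
      using less.prems d(2) by (intro less.hyps) (auto simp: q')
    then show ?thesis
      unfolding q' by (intro bounded_below_poly_blinfun_mult d)
  qed
qed

text \<open>Vectors on which \<open>T = p(A)\<close> nearly attains its norm \<open>M\<close> are
  nearly eigenvectors of \<open>T^2\<close> for \<open>M^2\<close>. Quantitatively, a lower bound
  \<open>c\<close> for \<open>T^2 - M^2\<close> would improve the norm of \<open>T\<close> to
  \<open>sqrt (M^4 - c^2) / M < M\<close>.\<close>

lemma not_bounded_below_power2_minus_norm:
  fixes A :: "'v :: real_inner \<Rightarrow>\<^sub>L 'v" and p :: "real poly"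
  assumes A: "selfadjoint A" and nontriv: "\<exists>x :: 'v. x \<noteq> 0"
  defines "M \<equiv> norm (poly_blinfun p A)"
  shows "\<not> bounded_below (poly_blinfun (p * p - [:M\<^sup>2:]) A)"
proof
  let ?T = "poly_blinfun p A"
  have T: "poly_blinfun (p * p - [:M\<^sup>2:]) A x = ?T (?T x) - M\<^sup>2 *\<^sub>R x" for x
    by (simp add: poly_blinfun_diff poly_blinfun_const poly_blinfun_mult_apply blinfun.bilinear_simps)
  assume "bounded_below (poly_blinfun (p * p - [:M\<^sup>2:]) A)"
  then obtain c where c: "c > 0" "\<And>x. c * norm x \<le> norm (?T (?T x) - M\<^sup>2 *\<^sub>R x)"
    unfolding bounded_below_def T by blast
  have key: "M\<^sup>2 * (norm (?T x))\<^sup>2 \<le> (M ^ 4 - c\<^sup>2) * (norm x)\<^sup>2" for x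
  proof -
    have "(c * norm x)\<^sup>2 \<le> (norm (?T (?T x) - M\<^sup>2 *\<^sub>R x))\<^sup>2"
      by (intro power_mono c(2) mult_nonneg_nonneg less_imp_le[OF c(1)] norm_ge_zero)
    also have "\<dots> = (norm (?T (?T x)))\<^sup>2 - 2 * M\<^sup>2 * (norm (?T x))\<^sup>2 + M ^ 4 * (norm x)\<^sup>2"
    proof -
      have sq: "(norm (w - s *\<^sub>R x))\<^sup>2 = (norm w)\<^sup>2 - 2 * s * (x \<bullet> w) + s\<^sup>2 * (norm x)\<^sup>2"
        for w :: 'v and s
        unfolding power2_norm_eq_inner
        by (simp add: inner_diff_left inner_diff_right inner_commute[of w x]
            algebra_simps power2_eq_square[of s])
      have "x \<bullet> ?T (?T x) = (norm (?T x))\<^sup>2"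
        unfolding power2_norm_eq_inner
        by (rule selfadjointD[OF selfadjoint_poly_blinfun[OF A], symmetric])
      moreover have "(M\<^sup>2)\<^sup>2 = M ^ 4" by simp
      ultimately show ?thesis unfolding sq by simp
    qed
    also have "\<dots> \<le> (M * norm (?T x))\<^sup>2 - 2 * M\<^sup>2 * (norm (?T x))\<^sup>2 + M ^ 4 * (norm x)\<^sup>2"
      unfolding M_def by (intro add_right_mono diff_right_mono power_mono norm_blinfun) auto
    finally show ?thesis by (simp add: power_mult_distrib algebra_simps)
  qed
  \<comment> \<open>A nonzero vector turns \<open>key\<close> into \<open>c^2 \<le> M^4\<close>,
    which legitimizes the square root in \<open>K\<close> and excludes \<open>M = 0\<close>.\<close>
  obtain x0 :: 'v where x0: "x0 \<noteq> 0" using nontriv by blast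
  have "0 \<le> M\<^sup>2 * (norm (?T x0))\<^sup>2" by simp
  also have "\<dots> \<le> (M ^ 4 - c\<^sup>2) * (norm x0)\<^sup>2" by (rule key)
  finally have nonneg: "0 \<le> M ^ 4 - c\<^sup>2" using x0 by (simp add: zero_le_mult_iff)
  have "M \<noteq> 0" using nonneg c(1) by auto
  then have "M > 0" unfolding M_def by simp
  define K where "K = sqrt (M ^ 4 - c\<^sup>2) / M"
  have "norm (?T x) \<le> K * norm x" for x
  proof (rule power2_le_imp_le)
    have "(K * norm x)\<^sup>2 = (M ^ 4 - c\<^sup>2) * (norm x)\<^sup>2 / M\<^sup>2"
      using nonneg by (simp add: K_def power_mult_distrib power_divide)
    then show "(norm (?T x))\<^sup>2 \<le> (K * norm x)\<^sup>2"
      using key[of x] \<open>M > 0\<close> by (simp add: pos_le_divide_eq mult.commute)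
    show "0 \<le> K * norm x" using \<open>M > 0\<close> nonneg by (simp add: K_def)
  qed
  then have "M \<le> K"
    unfolding M_def using \<open>M > 0\<close> nonneg by (intro norm_blinfun_bound) (auto simp: K_def M_def)
  have "sqrt (M ^ 4 - c\<^sup>2) < sqrt (M ^ 4)" using c(1) by (intro real_sqrt_less_mono) simp
  moreover have "sqrt (M ^ 4) = M * M"
    using \<open>M > 0\<close> by (intro real_sqrt_unique) (auto simp: power2_eq_square power4_eq_xxxx)
  ultimately have "sqrt (M ^ 4 - c\<^sup>2) < M * M" by simp
  then have "K < M" using \<open>M > 0\<close> by (simp add: K_def pos_divide_less_eq)
  with \<open>M \<le> K\<close> show False by simp
qed

text \<open>With \<open>M\<close> the norm of \<open>p(A)\<close>, the polynomial
  \<open>p^2 - M^2\<close> must have a root in the real spectrum, and there \<open>|p|\<close>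
  equals \<open>M\<close>.\<close>

theorem norm_poly_blinfun_attained:
  fixes A :: "'v :: real_inner \<Rightarrow>\<^sub>L 'v"
  assumes A: "selfadjoint A" and nontriv: "\<exists>x :: 'v. x \<noteq> 0"
  shows "\<exists>r\<in>real_spectrum A. norm (poly_blinfun p A) = \<bar>poly p r\<bar>"
proof -
  have *: "\<exists>r\<in>real_spectrum A. poly (p * p - [:(norm (poly_blinfun p A))\<^sup>2:]) r = 0"
    if "p * p - [:(norm (poly_blinfun p A))\<^sup>2:] \<noteq> 0" for p
    using bounded_below_poly_blinfun[OF A that] not_bounded_below_power2_minus_norm[OF A nontriv]
    by blast
  \<comment> \<open>The choice \<open>p = X\<close> shows that the spectrum is nonempty. This covers
    the degenerate case in which \<open>p^2 - M^2\<close> is the zero polynomial and any spectral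
    point will do.\<close>
  have "[:0, 1:] * [:0, 1:] - [:c:] \<noteq> (0 :: real poly)" for c
    by simp
  from *[OF this] have "real_spectrum A \<noteq> {}" by blast
  then have "\<exists>r\<in>real_spectrum A. poly (p * p - [:(norm (poly_blinfun p A))\<^sup>2:]) r = 0"
    using *[of p] by (cases "p * p - [:(norm (poly_blinfun p A))\<^sup>2:] = 0") auto
  then obtain r where "r \<in> real_spectrum A" "(poly p r)\<^sup>2 = (norm (poly_blinfun p A))\<^sup>2"
    by (auto simp: power2_eq_square)
  then show ?thesis
    by (intro bexI[of _ r]) (auto simp: power2_eq_iff)
qed

section \<open>Continuous functional calculus\<close>

lemma norm_blinfun_power_le:
  fixes A :: "'v :: real_normed_vector \<Rightarrow>\<^sub>L 'v"
  shows "norm (blinfun_power A n) \<le> norm A ^ n"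
proof (induction n)
  case 0
  show ?case by (simp add: norm_blinfun_id_le)
next
  case (Suc n)
  have "norm (A o\<^sub>L blinfun_power A n) \<le> norm A * norm (blinfun_power A n)"
    by (rule norm_blinfun_compose)
  also have "\<dots> \<le> norm A * norm A ^ n"
    by (intro mult_left_mono Suc.IH norm_ge_zero)
  finally show ?case by simp
qed

lemma blinfun_power_commute: "blinfun_power A n o\<^sub>L A = A o\<^sub>L blinfun_power A n"
  by (induction n) (auto intro!: blinfun_eqI dest: arg_cong[where f = blinfun_apply] simp: fun_eq_iff)

text \<open>For the geometric series \<open>R\<close>, dropping the first term gives
  \<open>B R = R - 1 = R B\<close>.\<close>

lemma neumann_inverse:
  fixes B :: "'v :: banach \<Rightarrow>\<^sub>L 'v"
  assumes "norm B < 1"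
  shows "\<exists>R. R o\<^sub>L (id_blinfun - B) = id_blinfun \<and> (id_blinfun - B) o\<^sub>L R = id_blinfun"
proof (intro exI conjI)
  interpret C: bounded_bilinear "(o\<^sub>L) :: ('v \<Rightarrow>\<^sub>L 'v) \<Rightarrow> _"
    by (rule bounded_bilinear_blinfun_compose)
  define R where "R = (\<Sum>n. blinfun_power B n)"
  have "summable (\<lambda>n. blinfun_power B n)"
    by (rule summable_comparison_test'[of "\<lambda>n. norm B ^ n" 0])
       (use assms norm_blinfun_power_le in auto)
  then have sums: "(\<lambda>n. blinfun_power B n) sums R" unfolding R_def by (rule summable_sums)
  have 1: "(\<lambda>n. blinfun_power B (Suc n)) sums (R - id_blinfun)"
    using sums by (subst sums_Suc_iff) simp
  have "(\<lambda>n. B o\<^sub>L blinfun_power B n) sums (B o\<^sub>L R)"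
    by (rule bounded_linear.sums[OF C.bounded_linear_right sums])
  then have BR: "B o\<^sub>L R = R - id_blinfun" using 1 sums_unique2 by simp
  have "(\<lambda>n. blinfun_power B n o\<^sub>L B) sums (R o\<^sub>L B)"
    by (rule bounded_linear.sums[OF C.bounded_linear_left sums])
  then have RB: "R o\<^sub>L B = R - id_blinfun" using 1 sums_unique2 by (simp add: blinfun_power_commute)
  have id: "T o\<^sub>L id_blinfun = T" "id_blinfun o\<^sub>L T = T" for T :: "'v \<Rightarrow>\<^sub>L 'v"
    by (auto intro: blinfun_eqI)
  show "R o\<^sub>L (id_blinfun - B) = id_blinfun" by (simp add: C.diff_right RB id)
  show "(id_blinfun - B) o\<^sub>L R = id_blinfun" by (simp add: C.diff_left BR id)
qed

text \<open>If \<open>|E| > M\<close>, then \<open>A - E = -E (1 - A / E)\<close> is inverted by a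
  Neumann series. The interval depends on the norm bound alone and hence serves all phases.\<close>

lemma real_spectrum_subset:
  fixes A :: "'v :: banach \<Rightarrow>\<^sub>L 'v"
  assumes "norm A \<le> M"
  shows "real_spectrum A \<subseteq> {-M..M}"
proof (rule ccontr)
  assume "\<not> ?thesis"
  then obtain E where E: "E \<in> real_spectrum A" "\<bar>E\<bar> > M" by (force simp: subset_iff)
  have "E \<noteq> 0" using E(2) assms norm_ge_zero[of A] by linarith
  have "norm (A /\<^sub>R E) < 1"
    using E(2) assms \<open>E \<noteq> 0\<close> by (simp add: field_simps)
  then obtain R where R: "R o\<^sub>L (id_blinfun - A /\<^sub>R E) = id_blinfun"
      "(id_blinfun - A /\<^sub>R E) o\<^sub>L R = id_blinfun"
    using neumann_inverse by blast
  interpret C: bounded_bilinear "(o\<^sub>L) :: ('v \<Rightarrow>\<^sub>L 'v) \<Rightarrow> _"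
    by (rule bounded_bilinear_blinfun_compose)
  have A: "A - E *\<^sub>R id_blinfun = (- E) *\<^sub>R (id_blinfun - A /\<^sub>R E)"
    using \<open>E \<noteq> 0\<close> by (simp add: scaleR_diff_right)
  have "((- 1 / E) *\<^sub>R R) o\<^sub>L (A - E *\<^sub>R id_blinfun) = id_blinfun"
       "(A - E *\<^sub>R id_blinfun) o\<^sub>L ((- 1 / E) *\<^sub>R R) = id_blinfun"
    unfolding A C.scaleR_left C.scaleR_right R using \<open>E \<noteq> 0\<close> by simp_all
  then show False using E(1) unfolding real_spectrum_def by blast
qed

lemma norm_poly_blinfun_le:
  fixes A :: "'v :: real_inner \<Rightarrow>\<^sub>L 'v"
  assumes "selfadjoint A" "\<exists>x :: 'v. x \<noteq> 0"
    and "\<And>t. t \<in> real_spectrum A \<Longrightarrow> \<bar>poly p t\<bar> \<le> e"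
  shows "norm (poly_blinfun p A) \<le> e"
  using norm_poly_blinfun_attained[OF assms(1,2), of p] assms(3) by auto

text \<open>Resolves the definite description: differences of approximating polynomials are
  uniformly small on the spectrum, hence small in operator norm, so all approximating sequences
  share one limit.\<close>

lemma cont_calculus_tendsto:
  fixes A :: "'v :: {real_inner, banach} \<Rightarrow>\<^sub>L 'v"
  assumes A: "selfadjoint A" "\<exists>x :: 'v. x \<noteq> 0"
    and p: "uniform_limit (real_spectrum A) (\<lambda>n. poly (p n)) g sequentially"
  shows "(\<lambda>n. poly_blinfun (p n) A) \<longlonglongrightarrow> cont_calculus g A"
proof -
  have "Cauchy (\<lambda>n. poly_blinfun (p n) A)"
  proof (rule metric_CauchyI)
    fix e :: real assume "e > 0"
    then have "e / 4 > 0" by simp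
    then obtain N where N: "\<And>n t. n \<ge> N \<Longrightarrow> t \<in> real_spectrum A \<Longrightarrow> dist (poly (p n) t) (g t) < e / 4"
      using uniform_limitD[OF p] unfolding eventually_sequentially by blast
    have "dist (poly_blinfun (p m) A) (poly_blinfun (p n) A) < e" if mn: "m \<ge> N" "n \<ge> N" for m n
    proof -
      have "norm (poly_blinfun (p m - p n) A) \<le> e / 2"
        using A
      proof (rule norm_poly_blinfun_le)
        fix t assume "t \<in> real_spectrum A"
        then show "\<bar>poly (p m - p n) t\<bar> \<le> e / 2"
          using N[OF mn(1), of t] N[OF mn(2), of t] unfolding dist_real_def poly_diff by linarith
      qed
      then show ?thesis using \<open>e > 0\<close> by (simp add: dist_norm poly_blinfun_diff)
    qed
    then show "\<exists>M. \<forall>m\<ge>M. \<forall>n\<ge>M. dist (poly_blinfun (p m) A) (poly_blinfun (p n) A) < e" by blast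
  qed
  then obtain T where T: "(\<lambda>n. poly_blinfun (p n) A) \<longlonglongrightarrow> T"
    by (auto simp: Cauchy_convergent_iff convergent_def)
  have other: "(\<lambda>n. poly_blinfun (q n) A) \<longlonglongrightarrow> T"
    if q: "uniform_limit (real_spectrum A) (\<lambda>n. poly (q n)) g sequentially" for q
  proof -
    have "(\<lambda>n. poly_blinfun (q n - p n) A) \<longlonglongrightarrow> 0"
    proof (rule LIMSEQ_I)
      fix e :: real assume "e > 0"
      then have "e / 4 > 0" by simp
      from uniform_limitD[OF p this] uniform_limitD[OF q this]
      have "\<forall>\<^sub>F n in sequentially. norm (poly_blinfun (q n - p n) A - 0) < e"
      proof eventually_elim
        case (elim n)
        have "norm (poly_blinfun (q n - p n) A) \<le> e / 2"
          using A
        proof (rule norm_poly_blinfun_le)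
          fix t assume "t \<in> real_spectrum A"
          then show "\<bar>poly (q n - p n) t\<bar> \<le> e / 2"
            using elim(1)[rule_format, of t] elim(2)[rule_format, of t]
            unfolding dist_real_def poly_diff by linarith
        qed
        then show ?case using \<open>e > 0\<close> by simp
      qed
      then show "\<exists>no. \<forall>n\<ge>no. norm (poly_blinfun (q n - p n) A - 0) < e"
        unfolding eventually_sequentially .
    qed
    from tendsto_add[OF this T] show ?thesis by (simp add: poly_blinfun_diff)
  qed
  have "cont_calculus g A = T"
    unfolding cont_calculus_def
  proof (rule the_equality)
    \<comment> \<open>Uniqueness relies on the given \<open>p\<close>: if no sequence approximated
      \<open>g\<close>, the condition would be vacuous and every operator would satisfy it.\<close>
    fix T' assume "\<forall>p. uniform_limit (real_spectrum A) (\<lambda>n. poly (p n)) g sequentially \<longrightarrow>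
      (\<lambda>n. poly_blinfun (p n) A) \<longlonglongrightarrow> T'"
    then show "T' = T" using p T LIMSEQ_unique by blast
  qed (use other in blast)
  then show ?thesis using T by simp
qed

lemma polynomial_approx:
  fixes g :: "real \<Rightarrow> real"
  assumes "continuous_on {a..b} g" "e > 0"
  shows "\<exists>p :: real poly. \<forall>t\<in>{a..b}. \<bar>poly p t - g t\<bar> < e"
proof -
  obtain f where f: "real_polynomial_function f" "\<And>t. t \<in> {a..b} \<Longrightarrow> \<bar>g t - f t\<bar> < e"
    using Stone_Weierstrass_real_polynomial_function[OF compact_Icc assms] by blast
  then obtain c n where "f = (\<lambda>x. \<Sum>i\<le>n. c i * x ^ i)"
    unfolding real_polynomial_function_iff_sum by blast
  then have "poly (\<Sum>i\<le>n. monom (c i) i) t = f t" for t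
    by (simp add: poly_sum poly_monom)
  then show ?thesis
    using f(2) by (metis abs_minus_commute)
qed

lemma polynomial_uniform_limit:
  fixes g :: "real \<Rightarrow> real"
  assumes "continuous_on {a..b} g"
  obtains p :: "nat \<Rightarrow> real poly" where "\<And>n t. t \<in> {a..b} \<Longrightarrow> \<bar>poly (p n) t - g t\<bar> < 1 / Suc n"
    "uniform_limit {a..b} (\<lambda>n. poly (p n)) g sequentially"
proof -
  have "\<forall>n. \<exists>p :: real poly. \<forall>t\<in>{a..b}. \<bar>poly p t - g t\<bar> < 1 / Suc n"
    by (intro allI polynomial_approx assms) simp
  then obtain p :: "nat \<Rightarrow> real poly" where p: "\<And>n t. t \<in> {a..b} \<Longrightarrow> \<bar>poly (p n) t - g t\<bar> < 1 / Suc n"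
    by metis
  moreover have "uniform_limit {a..b} (\<lambda>n. poly (p n)) g sequentially"
  proof (rule uniform_limitI)
    fix e :: real assume "e > 0"
    have "\<forall>\<^sub>F n in sequentially. 1 / Suc n < e"
      using order_tendstoD(2)[OF LIMSEQ_inverse_real_of_nat \<open>e > 0\<close>] by (simp add: inverse_eq_divide)
    then show "\<forall>\<^sub>F n in sequentially. \<forall>t\<in>{a..b}. dist (poly (p n) t) (g t) < e"
      unfolding dist_real_def by eventually_elim (intro ballI, rule less_trans[OF p])
  qed
  ultimately show thesis by (rule that)
qed

text \<open>Interval and rate refer to no operator, so the same polynomials can be used for every
  phase.\<close>

lemma polynomial_approximants:
  fixes g :: "real \<Rightarrow> real"
  assumes "continuous_on UNIV g"
  obtains p where "\<And>n t. \<bar>t\<bar> \<le> M \<Longrightarrow> \<bar>poly (p n) t - g t\<bar> \<le> 1 / real (Suc n)"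
proof -
  obtain p where p: "\<And>n t. t \<in> {- M..M} \<Longrightarrow> \<bar>poly (p n) t - g t\<bar> < 1 / real (Suc n)"
    using polynomial_uniform_limit[OF continuous_on_subset[OF assms subset_UNIV]] by metis
  show thesis
    by (rule that, rule less_imp_le, rule p) auto
qed

lemma inverse_Suc_tendsto_0: "(\<lambda>n. 1 / real (Suc n)) \<longlonglongrightarrow> 0"
  using LIMSEQ_inverse_real_of_nat by (simp add: inverse_eq_divide)

lemma tendsto_if_within_inverse_Suc:
  assumes "\<And>n. \<bar>f n - (l :: real)\<bar> \<le> 1 / real (Suc n)"
  shows "f \<longlonglongrightarrow> l"
  by (rule Lim_null[THEN iffD2], rule Lim_null_comparison[OF _ inverse_Suc_tendsto_0])
     (use assms in simp)

text \<open>Comparing \<open>p\<close> with closer and closer approximants \<open>q n\<close>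
  carries the spectral bound for polynomials over to \<open>g\<close>.\<close>

lemma cont_calculus_approx:
  fixes A :: "'v :: {real_inner, banach} \<Rightarrow>\<^sub>L 'v"
  assumes A: "selfadjoint A" "\<exists>x :: 'v. x \<noteq> 0" and M: "norm A \<le> M"
    and g: "continuous_on {-M..M} g"
    and p: "\<And>t. t \<in> {-M..M} \<Longrightarrow> \<bar>poly p t - g t\<bar> \<le> e"
  shows "norm (poly_blinfun p A - cont_calculus g A) \<le> e"
proof -
  obtain q where q: "\<And>n t. t \<in> {-M..M} \<Longrightarrow> \<bar>poly (q n) t - g t\<bar> < 1 / Suc n"
    and lim: "uniform_limit {-M..M} (\<lambda>n. poly (q n)) g sequentially"
    using polynomial_uniform_limit[OF g] by blast
  have "(\<lambda>n. poly_blinfun (q n) A) \<longlonglongrightarrow> cont_calculus g A"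
    by (intro cont_calculus_tendsto A uniform_limit_on_subset[OF lim] real_spectrum_subset M)
  then have 1: "(\<lambda>n. norm (poly_blinfun p A - poly_blinfun (q n) A)) \<longlonglongrightarrow>
      norm (poly_blinfun p A - cont_calculus g A)"
    by (intro tendsto_intros)
  have 2: "(\<lambda>n. e + 1 / Suc n) \<longlonglongrightarrow> e + 0"
    by (intro tendsto_intros LIMSEQ_inverse_real_of_nat[unfolded inverse_eq_divide])
  have 3: "norm (poly_blinfun p A - poly_blinfun (q n) A) \<le> e + 1 / Suc n" for n
    unfolding poly_blinfun_diff[symmetric] using A
  proof (rule norm_poly_blinfun_le)
    fix t assume "t \<in> real_spectrum A"
    then have "t \<in> {-M..M}" using real_spectrum_subset[OF M] by blast
    then show "\<bar>poly (p - q n) t\<bar> \<le> e + 1 / Suc n"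
      using p[of t] q[of t n] unfolding poly_diff by linarith
  qed
  show ?thesis using LIMSEQ_le[OF 1 2] 3 by auto
qed

section \<open>Lattice operators\<close>

lemma l2_cinner_delta: "l2_cinner (l2_delta j) x = l2_nth x j"
proof -
  have "l2_cinner (l2_delta j) x = (\<Sum>\<^sub>\<infinity>i\<in>{j}. cnj (l2_nth (l2_delta j) i) * l2_nth x i)"
    unfolding l2_cinner_def by (rule infsum_cong_neutral) (auto simp: l2_delta.rep_eq)
  then show ?thesis by (simp add: l2_delta.rep_eq)
qed

lemma inner_l2_delta: "l2_delta j \<bullet> x = Re (l2_nth x j)"
  by (simp add: inner_l2_def l2_cinner_delta)

lemma norm_l2_delta: "norm (l2_delta j) = 1"
  by (simp add: norm_eq_1 inner_l2_delta l2_delta.rep_eq)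

text \<open>On the zero space every operator is invertible and the real spectrum is empty, so
  attaining the norm on it presupposes a nonzero vector.\<close>

lemma l2_nontrivial: "\<exists>x :: 'a l2. x \<noteq> 0"
  using norm_l2_delta[of undefined] by (metis norm_zero zero_neq_one)

lemma inner_l2_eq_infsum: "x \<bullet> y = (\<Sum>\<^sub>\<infinity>i. Re (cnj (l2_nth x i) * l2_nth y i))"
  unfolding inner_l2_def l2_cinner_def by (rule infsum_Re[symmetric, OF l2_cinner_summable])

lift_definition l2_shift :: "'a :: ab_group_add \<Rightarrow> 'a l2 \<Rightarrow> 'a l2" is "\<lambda>k f i. f (i + k)"
proof -
  fix k :: 'a and f :: "'a \<Rightarrow> complex"
  assume "(\<lambda>i. (cmod (f i))\<^sup>2) summable_on UNIV"
  moreover have "bij (\<lambda>i. i + k)"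
    by (rule o_bij[of "\<lambda>i. i - k"]) (auto simp: fun_eq_iff)
  ultimately show "(\<lambda>i. (cmod (f (i + k)))\<^sup>2) summable_on UNIV"
    by (rule square_summable_reindex)
qed

lemma inner_l2_shift: "l2_shift k x \<bullet> y = x \<bullet> l2_shift (- k) y"
proof -
  have "bij (\<lambda>i. i + k)"
    by (rule o_bij[of "\<lambda>i. i - k"]) (auto simp: fun_eq_iff)
  from infsum_reindex_bij_betw[OF this, of "\<lambda>i. Re (cnj (l2_nth x i) * l2_nth y (i - k))"]
  show ?thesis by (simp add: inner_l2_eq_infsum l2_shift.rep_eq)
qed

lemma norm_l2_shift: "norm (l2_shift k x) = norm x"
proof -
  have "l2_shift (- k) (l2_shift k x) = x"
    by (rule l2_eqI) (simp add: l2_shift.rep_eq)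
  then show ?thesis by (simp add: norm_eq_sqrt_inner inner_l2_shift)
qed

lemma l2_nth_sum: "l2_nth (\<Sum>k\<in>S. f k) i = (\<Sum>k\<in>S. l2_nth (f k) i)"
  by (induction S rule: infinite_finite_induct) (auto simp: zero_l2.rep_eq plus_l2.rep_eq)

text \<open>Treats the one- and two-dimensional Hamiltonians together: \<open>K\<close> lists the
  neighbours of the origin and \<open>v\<close> is the potential. Symmetry of \<open>K\<close> and
  reality of \<open>v\<close> give self-adjointness; \<open>card K + C\<close> bounds the
  norm.\<close>

locale lattice_operator =
  fixes T :: "'a :: ab_group_add l2 \<Rightarrow>\<^sub>L 'a l2" and K :: "'a set" and v :: "'a \<Rightarrow> real" and C :: real
  assumes finite_K: "finite K"
    and symmetric_K: "uminus ` K = K"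
    and v_bound: "\<And>i. \<bar>v i\<bar> \<le> C"
    and apply_nth: "\<And>\<psi> i. l2_nth (T \<psi>) i = (\<Sum>k\<in>K. l2_nth \<psi> (i + k)) + of_real (v i) * l2_nth \<psi> i"
begin

definition multiplier :: "'a l2 \<Rightarrow> 'a l2" where
  "multiplier \<psi> = Abs_l2 (\<lambda>i. of_real (v i) * l2_nth \<psi> i)"

lemma multiplier_nth: "l2_nth (multiplier \<psi>) i = of_real (v i) * l2_nth \<psi> i"
  unfolding multiplier_def
  by (subst bounded_linear_l2_mult(2)[where C = C]) (use v_bound in auto)

lemma T_eq: "T \<psi> = (\<Sum>k\<in>K. l2_shift k \<psi>) + multiplier \<psi>"
  by (rule l2_eqI) (simp add: apply_nth plus_l2.rep_eq l2_nth_sum l2_shift.rep_eq multiplier_nth)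

lemma selfadjoint: "selfadjoint T"
  unfolding selfadjoint_def
proof (intro allI)
  fix x y
  have "(\<Sum>k\<in>K. l2_shift k x) \<bullet> y = (\<Sum>k\<in>K. x \<bullet> l2_shift (- k) y)"
    by (simp add: inner_sum_left inner_l2_shift)
  also have "\<dots> = (\<Sum>k\<in>uminus ` K. x \<bullet> l2_shift k y)"
    by (subst sum.reindex) auto
  also have "\<dots> = x \<bullet> (\<Sum>k\<in>K. l2_shift k y)"
    by (simp add: symmetric_K inner_sum_right)
  finally have 1: "(\<Sum>k\<in>K. l2_shift k x) \<bullet> y = x \<bullet> (\<Sum>k\<in>K. l2_shift k y)" .
  have 2: "multiplier x \<bullet> y = x \<bullet> multiplier y"
    unfolding inner_l2_eq_infsum by (rule infsum_cong) (simp add: multiplier_nth algebra_simps)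
  show "T x \<bullet> y = x \<bullet> T y"
    by (simp add: T_eq inner_add_left inner_add_right 1 2)
qed

lemma norm_le: "norm T \<le> real (card K) + C"
proof (rule norm_blinfun_bound)
  have C: "0 \<le> C" using v_bound[of 0] by (rule order_trans[OF abs_ge_zero])
  then show "0 \<le> real (card K) + C" by simp
  fix \<psi>
  have v2: "(v i)\<^sup>2 \<le> C\<^sup>2" for i
    using power_mono[OF v_bound abs_ge_zero, of i 2] by simp
  have "(norm (multiplier \<psi>))\<^sup>2 \<le> (C * norm \<psi>)\<^sup>2"
    unfolding norm_l2_power2 power_mult_distrib infsum_cmult_right'[symmetric]
    by (intro infsum_mono l2_nth_summable summable_on_cmult_right)
       (simp add: multiplier_nth norm_mult power_mult_distrib mult_right_mono v2)
  then have "norm (multiplier \<psi>) \<le> C * norm \<psi>"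
    using C by (auto intro: power2_le_imp_le)
  moreover have "norm (\<Sum>k\<in>K. l2_shift k \<psi>) \<le> real (card K) * norm \<psi>"
    by (rule order_trans[OF norm_sum]) (simp add: norm_l2_shift)
  ultimately show "norm (blinfun_apply T \<psi>) \<le> (real (card K) + C) * norm \<psi>"
    unfolding T_eq distrib_right by (intro norm_triangle_mono) auto
qed

definition moment :: "nat \<Rightarrow> real" where
  "moment k = l2_delta 0 \<bullet> blinfun_power T k (l2_delta 0)"

text \<open>All matrix entries of \<open>T\<close> are real. This is how the complex
  \<open>l2_cinner\<close> in the density of states is recovered from the real inner product, which
  sees only its real part.\<close>

lemma power_delta_real: "l2_nth (blinfun_power T k (l2_delta j)) i \<in> \<real>"
  by (induction k arbitrary: i) (auto simp: l2_delta.rep_eq apply_nth intro!: sum_in_Reals)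

lemma poly_delta_real: "l2_nth (poly_blinfun p T (l2_delta j)) i \<in> \<real>"
proof -
  have "l2_nth (c *\<^sub>R x) i \<in> \<real>" if "l2_nth x i \<in> \<real>" for c and x :: "'a l2"
    using that by (simp add: scaleR_l2.rep_eq)
  then show ?thesis
    unfolding poly_blinfun_def blinfun.sum_left l2_nth_sum
    by (intro sum_in_Reals) (auto simp: blinfun.scaleR_left power_delta_real)
qed

lemma poly_form: "l2_delta 0 \<bullet> poly_blinfun p T (l2_delta 0) = (\<Sum>k\<le>degree p. coeff p k * moment k)"
  by (simp add: poly_blinfun_def blinfun.sum_left blinfun.scaleR_left inner_sum_right moment_def)

text \<open>Integration of \<open>g\<close> against the spectral measure of \<open>T\<close> at the
  origin, kept as a functional; averaging it over the phase gives the density of states.\<close>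

definition form :: "(real \<Rightarrow> real) \<Rightarrow> real" where
  "form g = l2_delta 0 \<bullet> cont_calculus g T (l2_delta 0)"

lemma cont_calculus_tendsto_form:
  assumes p: "uniform_limit {-(real (card K) + C)..real (card K) + C} (\<lambda>n. poly (p n)) g sequentially"
  shows "(\<lambda>n. poly_blinfun (p n) T) \<longlonglongrightarrow> cont_calculus g T"
  by (intro cont_calculus_tendsto selfadjoint l2_nontrivial uniform_limit_on_subset[OF p]
      real_spectrum_subset norm_le)

lemma cinner_cont_calculus:
  assumes "continuous_on UNIV g"
  shows "l2_cinner (l2_delta 0) (cont_calculus g T (l2_delta 0)) = of_real (form g)"
proof -
  obtain p where "uniform_limit {-(real (card K) + C)..real (card K) + C} (\<lambda>n. poly (p n)) g sequentially"
    using polynomial_uniform_limit[OF continuous_on_subset[OF assms subset_UNIV]] by blast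
  then have "(\<lambda>n. l2_nth (poly_blinfun (p n) T (l2_delta 0)) 0) \<longlonglongrightarrow> l2_nth (cont_calculus g T (l2_delta 0)) 0"
    by (intro tendsto_l2_nth blinfun.tendsto tendsto_const cont_calculus_tendsto_form)
  then have "l2_nth (cont_calculus g T (l2_delta 0)) 0 \<in> \<real>"
    by (rule closed_sequentially[OF closed_complex_Reals, rotated]) (simp add: poly_delta_real)
  then show ?thesis
    unfolding form_def l2_cinner_delta inner_l2_delta by simp
qed

text \<open>The source of linearity, positivity and integrability in the phase: the error depends
  only on how well \<open>p\<close> approximates \<open>g\<close> on a fixed interval.\<close>

lemma form_approx:
  assumes "continuous_on UNIV g"
    and "\<And>t. \<bar>t\<bar> \<le> real (card K) + C \<Longrightarrow> \<bar>poly p t - g t\<bar> \<le> e"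
  shows "\<bar>(\<Sum>k\<le>degree p. coeff p k * moment k) - form g\<bar> \<le> e"
proof -
  let ?D = "poly_blinfun p T - cont_calculus g T"
  have "norm ?D \<le> e"
    by (rule cont_calculus_approx[OF selfadjoint l2_nontrivial norm_le])
       (use assms(2) in \<open>auto intro: continuous_on_subset[OF assms(1)]\<close>)
  moreover have "norm (?D (l2_delta 0)) \<le> norm ?D"
    using norm_blinfun[of ?D "l2_delta 0"] by (simp add: norm_l2_delta)
  moreover have "\<bar>l2_delta 0 \<bullet> ?D (l2_delta 0)\<bar> \<le> norm (?D (l2_delta 0))"
    using Cauchy_Schwarz_ineq2[of "l2_delta 0" "?D (l2_delta 0)"] by (simp add: norm_l2_delta)
  ultimately show ?thesis
    by (simp add: form_def blinfun.diff_left inner_diff_right poly_form)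
qed

lemma form_polynomial_limit:
  assumes "continuous_on UNIV g"
    and "\<And>n t. \<bar>t\<bar> \<le> real (card K) + C \<Longrightarrow> \<bar>poly (p n) t - g t\<bar> \<le> e n" and e: "e \<longlonglongrightarrow> 0"
  shows "(\<lambda>n. l2_delta 0 \<bullet> poly_blinfun (p n) T (l2_delta 0)) \<longlonglongrightarrow> form g"
  by (rule Lim_null[THEN iffD2], rule Lim_null_comparison[OF _ e])
     (use form_approx[OF assms(1,2)] in \<open>simp add: poly_form\<close>)

lemma form_approximants:
  assumes "continuous_on UNIV g"
  obtains p where "\<And>n t. \<bar>t\<bar> \<le> real (card K) + C \<Longrightarrow> \<bar>poly (p n) t - g t\<bar> \<le> 1 / real (Suc n)"
    "(\<lambda>n. l2_delta 0 \<bullet> poly_blinfun (p n) T (l2_delta 0)) \<longlonglongrightarrow> form g"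
proof -
  obtain p where p: "\<And>n t. \<bar>t\<bar> \<le> real (card K) + C \<Longrightarrow> \<bar>poly (p n) t - g t\<bar> \<le> 1 / real (Suc n)"
    using polynomial_approximants[OF assms] by blast
  show thesis
    by (rule that[OF p form_polynomial_limit[OF assms p inverse_Suc_tendsto_0]])
qed

text \<open>The calculus is known only through limits of polynomials, so additivity is inherited
  from sums of approximants.\<close>

lemma form_add:
  assumes f: "continuous_on UNIV f" and g: "continuous_on UNIV g"
  shows "form (\<lambda>t. f t + g t) = form f + form g"
proof -
  obtain p where p: "\<And>n t. \<bar>t\<bar> \<le> real (card K) + C \<Longrightarrow> \<bar>poly (p n) t - f t\<bar> \<le> 1 / real (Suc n)"
    "(\<lambda>n. l2_delta 0 \<bullet> poly_blinfun (p n) T (l2_delta 0)) \<longlonglongrightarrow> form f"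
    using form_approximants[OF f] by blast
  obtain q where q: "\<And>n t. \<bar>t\<bar> \<le> real (card K) + C \<Longrightarrow> \<bar>poly (q n) t - g t\<bar> \<le> 1 / real (Suc n)"
    "(\<lambda>n. l2_delta 0 \<bullet> poly_blinfun (q n) T (l2_delta 0)) \<longlonglongrightarrow> form g"
    using form_approximants[OF g] by blast
  have "\<bar>poly (p n + q n) t - (f t + g t)\<bar> \<le> 1 / real (Suc n) + 1 / real (Suc n)" if "\<bar>t\<bar> \<le> real (card K) + C" for n t
    using p(1)[OF that, of n] q(1)[OF that, of n] unfolding poly_add by linarith
  then have "(\<lambda>n. l2_delta 0 \<bullet> poly_blinfun (p n + q n) T (l2_delta 0)) \<longlonglongrightarrow> form (\<lambda>t. f t + g t)"
    using tendsto_add[OF LIMSEQ_inverse_real_of_nat LIMSEQ_inverse_real_of_nat]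
    by (intro form_polynomial_limit[where e = "\<lambda>n. 1 / real (Suc n) + 1 / real (Suc n)"] continuous_intros f g)
       (auto simp: inverse_eq_divide)
  moreover have "(\<lambda>n. l2_delta 0 \<bullet> poly_blinfun (p n + q n) T (l2_delta 0)) \<longlonglongrightarrow> form f + form g"
    using tendsto_add[OF p(2) q(2)] by (simp add: poly_blinfun_add blinfun.add_left inner_add_right)
  ultimately show ?thesis by (rule LIMSEQ_unique)
qed

lemma form_scale:
  assumes f: "continuous_on UNIV f"
  shows "form (\<lambda>t. c * f t) = c * form f"
proof -
  obtain p where p: "\<And>n t. \<bar>t\<bar> \<le> real (card K) + C \<Longrightarrow> \<bar>poly (p n) t - f t\<bar> \<le> 1 / real (Suc n)"
    "(\<lambda>n. l2_delta 0 \<bullet> poly_blinfun (p n) T (l2_delta 0)) \<longlonglongrightarrow> form f"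
    using form_approximants[OF f] by blast
  have "\<bar>poly (smult c (p n)) t - c * f t\<bar> \<le> \<bar>c\<bar> * (1 / real (Suc n))" if "\<bar>t\<bar> \<le> real (card K) + C" for n t
    using mult_left_mono[OF p(1)[OF that, of n] abs_ge_zero[of c]]
    by (simp add: right_diff_distrib flip: abs_mult)
  moreover have "(\<lambda>n. \<bar>c\<bar> * (1 / real (Suc n))) \<longlonglongrightarrow> 0"
    using tendsto_mult_right_zero[OF LIMSEQ_inverse_real_of_nat] by (simp add: inverse_eq_divide)
  ultimately have "(\<lambda>n. l2_delta 0 \<bullet> poly_blinfun (smult c (p n)) T (l2_delta 0)) \<longlonglongrightarrow> form (\<lambda>t. c * f t)"
    by (intro form_polynomial_limit[where e = "\<lambda>n. \<bar>c\<bar> * (1 / real (Suc n))"] continuous_intros f) auto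
  moreover have "(\<lambda>n. l2_delta 0 \<bullet> poly_blinfun (smult c (p n)) T (l2_delta 0)) \<longlonglongrightarrow> c * form f"
    using tendsto_mult_left[OF p(2)] by (simp add: poly_blinfun_smult blinfun.scaleR_left)
  ultimately show ?thesis by (rule LIMSEQ_unique)
qed

lemma moment_0: "moment 0 = 1"
  by (simp add: moment_def norm_l2_delta flip: power2_norm_eq_inner)

lemma form_polynomial:
  assumes "continuous_on UNIV g" "\<And>t. \<bar>t\<bar> \<le> real (card K) + C \<Longrightarrow> g t = poly p t"
  shows "form g = (\<Sum>k\<le>degree p. coeff p k * moment k)"
  using form_approx[of g p 0] assms by simp

text \<open>If \<open>0 \<le> g \<le> 2 c\<close> on the spectrum, then the constant \<open>c\<close> is within \<open>c\<close> of \<open>g\<close>.\<close>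
lemma form_nonneg:
  assumes g: "continuous_on UNIV g" and nonneg: "\<And>t. \<bar>t\<bar> \<le> real (card K) + C \<Longrightarrow> 0 \<le> g t"
  shows "0 \<le> form g"
proof -
  let ?I = "{-(real (card K) + C)..real (card K) + C}"
  have "bounded (g ` ?I)"
    by (intro compact_imp_bounded compact_continuous_image continuous_on_subset[OF g]) auto
  then obtain B where B: "\<And>t. t \<in> ?I \<Longrightarrow> \<bar>g t\<bar> \<le> B"
    by (metis bounded_iff imageI real_norm_def)
  have "\<bar>poly [:B / 2:] t - g t\<bar> \<le> B / 2" if "\<bar>t\<bar> \<le> real (card K) + C" for t
    using B[of t] nonneg[OF that] that by (auto simp: abs_if field_simps split: if_splits)
  from form_approx[OF g this] have "\<bar>B / 2 - form g\<bar> \<le> B / 2" by (simp add: moment_0)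
  then show ?thesis by linarith
qed

end

section \<open>Representation of positive functionals on the line\<close>

lemma (in prob_space) abs_integral_diff_le:
  fixes f g :: "'a \<Rightarrow> real"
  assumes "integrable M f" "integrable M g" "AE x in M. \<bar>f x - g x\<bar> \<le> e"
  shows "\<bar>(\<integral>x. f x \<partial>M) - (\<integral>x. g x \<partial>M)\<bar> \<le> e"
proof -
  have "\<bar>\<integral>x. f x - g x \<partial>M\<bar> \<le> (\<integral>x. \<bar>f x - g x\<bar> \<partial>M)"
    by (rule integral_abs_bound)
  also have "\<dots> \<le> (\<integral>x. e \<partial>M)"
    using assms by (intro integral_mono_AE) auto
  finally show ?thesis
    using assms by (simp add: prob_space)
qed

text \<open>Measurability of the limit is part of the conclusion; this is how functions of the phase
  defined through the calculus become measurable.\<close>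

lemma (in prob_space) integrable_uniform_limit:
  fixes f :: "'a \<Rightarrow> real"
  assumes F: "\<And>n. integrable M (F n)"
    and approx: "\<And>n x. x \<in> space M \<Longrightarrow> \<bar>F n x - f x\<bar> \<le> e n" and e: "e \<longlonglongrightarrow> 0"
  shows "integrable M f"
proof -
  have "(\<lambda>n. F n x) \<longlonglongrightarrow> f x" if "x \<in> space M" for x
    by (rule Lim_null[THEN iffD2], rule Lim_null_comparison[OF _ e])
       (use approx[OF that] in auto)
  then have meas: "f \<in> borel_measurable M"
    by (rule borel_measurable_LIMSEQ_real[where u = F]) (use F in auto)
  show ?thesis
  proof (rule Bochner_Integration.integrable_bound)
    show "integrable M (\<lambda>x. \<bar>F 0 x\<bar> + e 0)" using F by auto
    show "AE x in M. norm (f x) \<le> norm (\<bar>F 0 x\<bar> + e 0)"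
    proof (rule AE_I2)
      fix x assume "x \<in> space M"
      from approx[OF this, of 0] show "norm (f x) \<le> norm (\<bar>F 0 x\<bar> + e 0)"
        unfolding real_norm_def by linarith
    qed
  qed (fact meas)
qed

definition ramp :: "real \<Rightarrow> real \<Rightarrow> real \<Rightarrow> real" where
  "ramp a b t = max 0 (min 1 ((b - t) / (b - a)))"

lemma continuous_on_ramp: "continuous_on S (ramp a b)"
  unfolding ramp_def divide_inverse by (intro continuous_intros)

lemma ramp_bounds: "0 \<le> ramp a b t" "ramp a b t \<le> 1"
  by (auto simp: ramp_def)

lemma ramp_eq_1: "a < b \<Longrightarrow> t \<le> a \<Longrightarrow> ramp a b t = 1"
  by (simp add: ramp_def field_simps)

lemma ramp_eq_0: "a < b \<Longrightarrow> b \<le> t \<Longrightarrow> ramp a b t = 0"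
  by (simp add: ramp_def field_simps max_def min_def)

text \<open>Positivity is tested on \<open>[-M, M]\<close> only, so \<open>L\<close> ignores values
  outside, and the representing measure is carried by this interval.\<close>

locale positive_functional =
  fixes L :: "(real \<Rightarrow> real) \<Rightarrow> real" and M :: real
  assumes M_nonneg: "0 \<le> M"
    and add: "continuous_on UNIV f \<Longrightarrow> continuous_on UNIV g \<Longrightarrow> L (\<lambda>t. f t + g t) = L f + L g"
    and scale: "continuous_on UNIV f \<Longrightarrow> L (\<lambda>t. c * f t) = c * L f"
    and nonneg: "continuous_on UNIV f \<Longrightarrow> (\<And>t. \<bar>t\<bar> \<le> M \<Longrightarrow> 0 \<le> f t) \<Longrightarrow> 0 \<le> L f"
    and one: "L (\<lambda>_. 1) = 1"
begin

lemma const: "L (\<lambda>_. c) = c"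
  using scale[of "\<lambda>_. 1" c] one by simp

lemma diff:
  assumes "continuous_on UNIV f" "continuous_on UNIV g"
  shows "L (\<lambda>t. f t - g t) = L f - L g"
proof -
  have "continuous_on UNIV (\<lambda>t. (- 1) * g t)" using assms(2) by (intro continuous_intros)
  from add[OF assms(1) this] scale[OF assms(2), of "-1"] show ?thesis by simp
qed

lemma mono:
  assumes "continuous_on UNIV f" "continuous_on UNIV g" "\<And>t. \<bar>t\<bar> \<le> M \<Longrightarrow> f t \<le> g t"
  shows "L f \<le> L g"
  using nonneg[of "\<lambda>t. g t - f t"] diff[OF assms(2,1)] assms
  by (auto intro: continuous_on_diff)

lemma approx:
  assumes f: "continuous_on UNIV f" and g: "continuous_on UNIV g"
    and "\<And>t. \<bar>t\<bar> \<le> M \<Longrightarrow> \<bar>f t - g t\<bar> \<le> e"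
  shows "\<bar>L f - L g\<bar> \<le> e"
proof -
  have "L (\<lambda>t. f t - g t) \<le> L (\<lambda>_. e)" "L (\<lambda>t. g t - f t) \<le> L (\<lambda>_. e)"
    using assms(3) by (intro mono continuous_intros f g; force)+
  then show ?thesis by (simp add: diff f g const)
qed

lemma sum:
  assumes "finite I" "\<And>i. i \<in> I \<Longrightarrow> continuous_on UNIV (f i)"
  shows "L (\<lambda>t. \<Sum>i\<in>I. c i * f i t) = (\<Sum>i\<in>I. c i * L (f i))"
  using assms
proof (induction I rule: finite_induct)
  case empty
  show ?case using const[of 0] by simp
next
  case (insert i I)
  have "L (\<lambda>t. c i * f i t + (\<Sum>i\<in>I. c i * f i t)) = c i * L (f i) + L (\<lambda>t. \<Sum>i\<in>I. c i * f i t)"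
    using insert.prems by (subst add) (auto intro!: continuous_intros simp: scale)
  with insert show ?case by simp
qed

section \<open>The distribution function of a positive functional\<close>

definition majorants :: "real \<Rightarrow> (real \<Rightarrow> real) set" where
  "majorants x = {g. continuous_on UNIV g \<and> (\<forall>t. 0 \<le> g t) \<and> (\<forall>t\<le>x. 1 \<le> g t)}"

text \<open>An upper integral of the indicator of \<open>{..x}\<close>. Approximating from above is
  what makes it continuous from the right.\<close>

definition F :: "real \<Rightarrow> real" where
  "F x = Inf (L ` majorants x)"

lemma F_le: "g \<in> majorants x \<Longrightarrow> F x \<le> L g"
  unfolding F_def
  by (rule cInf_lower) (auto simp: majorants_def intro!: bdd_belowI[of _ 0] nonneg)

lemma one_in_majorants: "(\<lambda>_. 1) \<in> majorants x"
  by (simp add: majorants_def)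

lemma F_ge: "(\<And>g. g \<in> majorants x \<Longrightarrow> c \<le> L g) \<Longrightarrow> c \<le> F x"
  unfolding F_def using one_in_majorants by (intro cInf_greatest) auto

lemma F_mono: "x \<le> y \<Longrightarrow> F x \<le> F y"
  by (rule F_ge, rule F_le) (auto simp: majorants_def)

lemma ramp_in_majorants: "a < b \<Longrightarrow> ramp a b \<in> majorants a"
  by (simp add: majorants_def continuous_on_ramp ramp_bounds ramp_eq_1)

text \<open>A ramp falling from 1 to 0 between \<open>x\<close> and \<open>-M\<close> vanishes on
  \<open>[-M, M]\<close>. The inequality is strict because there may be an atom at
  \<open>-M\<close>.\<close>

lemma F_eq_0: "x < - M \<Longrightarrow> F x = 0"
proof (rule antisym)
  assume x: "x < - M"
  have "F x \<le> L (ramp x (- M))" by (intro F_le ramp_in_majorants x)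
  also have "\<dots> \<le> L (\<lambda>_. 0)"
    by (intro mono continuous_on_ramp) (auto simp: ramp_eq_0 x)
  finally show "F x \<le> 0" by (simp add: const)
  show "0 \<le> F x" by (rule F_ge) (auto simp: majorants_def intro: nonneg)
qed

lemma F_eq_1: "M \<le> x \<Longrightarrow> F x = 1"
proof (rule antisym)
  show "F x \<le> 1" using F_le[OF one_in_majorants] one by simp
  assume x: "M \<le> x"
  show "1 \<le> F x"
  proof (rule F_ge)
    fix g assume "g \<in> majorants x"
    then have "L (\<lambda>_. 1) \<le> L g"
      using x by (intro mono) (auto simp: majorants_def)
    then show "1 \<le> L g" by (simp add: one)
  qed
qed

text \<open>Let \<open>g\<close> be a nearly optimal majorant at \<open>a\<close>. Since
  \<open>g a \<ge> 1\<close> and \<open>g\<close> is continuous, \<open>g + e / 2\<close> is still a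
  majorant at points slightly to the right of \<open>a\<close>.\<close>

lemma F_right_continuous: "continuous (at_right a) F"
  unfolding continuous_within
proof (rule tendstoI)
  fix e :: real assume e: "e > 0"
  have "\<exists>y\<in>L ` majorants a. y < F a + e / 2"
    using e one_in_majorants unfolding F_def by (intro cInf_lessD) auto
  then obtain g where g: "g \<in> majorants a" "L g < F a + e / 2" by blast
  then have cont: "continuous_on UNIV g" by (simp add: majorants_def)
  then have "isCont g a" by (simp add: continuous_on_eq_continuous_at)
  then obtain d where d: "d > 0" "\<And>t. \<bar>t - a\<bar> < d \<Longrightarrow> \<bar>g t - g a\<bar> < e / 2"
    using e unfolding isCont_def LIM_def dist_real_def
    by (metis abs_zero diff_self half_gt_zero)
  have "F x < F a + e" if x: "a < x" "x < a + d" for x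
  proof -
    have "1 \<le> g a" using g by (simp add: majorants_def)
    have "1 \<le> g t + e / 2" if "t \<le> x" for t
    proof (cases "t \<le> a")
      case True
      then have "1 \<le> g t" using g(1) by (simp add: majorants_def)
      then show ?thesis using e by simp
    next
      case False
      then have "\<bar>t - a\<bar> < d" using that x by simp
      from d(2)[OF this] \<open>1 \<le> g a\<close> show ?thesis by linarith
    qed
    moreover have "0 \<le> g t + e / 2" for t
      using g(1) e by (simp add: majorants_def)
    ultimately have "(\<lambda>t. g t + e / 2) \<in> majorants x"
      using cont by (auto simp: majorants_def intro!: continuous_intros)
    then have "F x \<le> L (\<lambda>t. g t + e / 2)" by (rule F_le)
    also have "\<dots> = L g + e / 2" using cont by (subst add) (auto simp: const)
    finally show ?thesis using g(2) by simp
  qed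
  moreover have "F a \<le> F x" if "a < x" for x using that by (intro F_mono) simp
  ultimately have "dist (F x) (F a) < e" if "a < x" "x < a + d" for x
    using that by (smt (verit) dist_real_def)
  then show "\<forall>\<^sub>F x in at_right a. dist (F x) (F a) < e"
    unfolding eventually_at_right_field using d(1) by (intro exI[of _ "a + d"]) auto
qed

lemma F_at_bot: "(F \<longlongrightarrow> 0) at_bot"
  by (rule tendsto_eventually)
     (use F_eq_0 in \<open>auto simp: eventually_at_bot_dense intro!: exI[of _ "- M"]\<close>)

definition \<nu> :: "real measure" where
  "\<nu> = interval_measure F"

sublocale \<nu>: real_distribution \<nu>
  unfolding \<nu>_def
proof (rule real_distribution_interval_measure)
  show "(F \<longlongrightarrow> 1) at_top"
    by (rule tendsto_eventually)
       (use F_eq_1 in \<open>auto simp: eventually_at_top_linorder intro!: exI[of _ M]\<close>)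
qed (use F_mono F_right_continuous F_at_bot in auto)

lemma measure_Iic: "measure \<nu> {..x} = F x"
  unfolding \<nu>_def by (intro measure_interval_measure_Iic F_mono F_right_continuous F_at_bot)

lemma integrable_continuous_bounded:
  assumes "continuous_on UNIV g" "bounded (range g)"
  shows "integrable \<nu> (g :: real \<Rightarrow> real)"
proof -
  obtain B where "\<And>x. norm (g x) \<le> B" using assms(2) by (auto simp: bounded_iff)
  then show ?thesis
    using assms(1) by (intro \<nu>.integrable_const_bound[of _ B])
      (auto intro!: \<nu>.measurable_finite_borel borel_measurable_continuous_onI)
qed

text \<open>A provisional support bound; the margin 1 leaves room for a possible atom at
  \<open>-M\<close>.\<close>

lemma AE_close: "AE x in \<nu>. \<bar>x\<bar> \<le> M + 1"
proof -
  have "AE x in \<nu>. x \<in> {..M}"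
    using measure_Iic[of M] F_eq_1[of M] by (intro \<nu>.AE_prob_1) simp
  moreover have "AE x in \<nu>. x \<notin> {..- M - 1}"
    using measure_Iic[of "- M - 1"] F_eq_0[of "- M - 1"] M_nonneg
    by (intro AE_not_in) (auto simp: null_sets_def \<nu>.emeasure_eq_measure)
  ultimately show ?thesis by eventually_elim auto
qed

lemma integrable_ramp: "integrable \<nu> (ramp a b)"
  using ramp_bounds by (intro integrable_continuous_bounded continuous_on_ramp)
    (auto simp: bounded_iff intro!: exI[of _ 1])

text \<open>The ramp lies between the indicators of \<open>{..a}\<close> and \<open>{..b}\<close>,
  so both its image under \<open>L\<close> and its integral lie between \<open>F a\<close> and
  \<open>F b\<close>.\<close>

lemma ramp_diff_le:
  assumes "a < b"
  shows "\<bar>L (ramp a b) - (\<integral>t. ramp a b t \<partial>\<nu>)\<bar> \<le> F b - F a"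
proof -
  have 1: "F a \<le> L (ramp a b)" by (intro F_le ramp_in_majorants assms)
  have 2: "L (ramp a b) \<le> F b"
  proof (rule F_ge)
    fix g assume g: "g \<in> majorants b"
    have "ramp a b t \<le> g t" for t
      using g ramp_bounds(2)[of a b t] ramp_eq_0[OF assms, of t]
      by (cases "t \<le> b") (force simp: majorants_def intro: order_trans)+
    then show "L (ramp a b) \<le> L g"
      using g by (intro mono continuous_on_ramp) (auto simp: majorants_def)
  qed
  have ind: "integrable \<nu> (indicat_real {..c})" for c
    by (intro integrable_real_indicator) (auto simp: \<nu>.emeasure_eq_measure)
  have "(\<integral>t. indicator {..a} t \<partial>\<nu>) \<le> (\<integral>t. ramp a b t \<partial>\<nu>)"
    by (intro integral_mono integrable_ramp ind)
       (auto simp: ramp_eq_1 assms ramp_bounds split: split_indicator)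
  then have 3: "F a \<le> (\<integral>t. ramp a b t \<partial>\<nu>)" by (simp add: measure_Iic)
  have "(\<integral>t. ramp a b t \<partial>\<nu>) \<le> (\<integral>t. indicator {..b} t \<partial>\<nu>)"
    by (intro integral_mono integrable_ramp ind)
       (auto simp: ramp_eq_0 assms ramp_bounds split: split_indicator)
  then have 4: "(\<integral>t. ramp a b t \<partial>\<nu>) \<le> F b" by (simp add: measure_Iic)
  show ?thesis using 1 2 3 4 by linarith
qed

text \<open>On a piecewise linear interpolant of \<open>g\<close> the two functionals differ, ramp
  by ramp, by at most \<open>e\<close> times an increment of \<open>F\<close>, hence by at most
  \<open>e\<close> in total. Replacing \<open>g\<close> by the interpolant costs another
  \<open>e\<close> on either side.\<close>

lemma integral_eq:
  assumes cont: "continuous_on UNIV g" and bdd: "bounded (range g)"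
  shows "(\<integral>t. g t \<partial>\<nu>) = L g"
proof -
  have "\<bar>L g - (\<integral>t. g t \<partial>\<nu>)\<bar> \<le> 3 * e" if e: "e > 0" for e
  proof -
    \<comment> \<open>The endpoints lie one unit outside \<open>[-M, M]\<close>, so that
      \<open>F\<close> is 0 at the first and 1 at the last grid point.\<close>
    define A B where "A = - M - 1" and "B = M + 1"
    have AB: "A < B" using M_nonneg by (simp add: A_def B_def)
    have "uniformly_continuous_on {A..B} g"
      by (intro compact_uniformly_continuous continuous_on_subset[OF cont]) auto
    then obtain d where d: "d > 0"
      "\<And>x y. x \<in> {A..B} \<Longrightarrow> y \<in> {A..B} \<Longrightarrow> \<bar>x - y\<bar> < d \<Longrightarrow> \<bar>g x - g y\<bar> < e"
      unfolding uniformly_continuous_on_def dist_real_def using e by metis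
    have near: "\<bar>g x - g y\<bar> \<le> e" if "x \<in> {A..B}" "y \<in> {A..B}" "\<bar>x - y\<bar> < d" for x y
      using d(2)[OF that] by simp
    obtain n where n: "(B - A) / d < real n" using reals_Archimedean2 by blast
    then have "n > 0" using AB d(1) by (cases n) (auto simp: divide_less_0_iff)
    define h where "h = (B - A) / n"
    have h: "0 < h" "h < d"
      using AB n d(1) \<open>n > 0\<close> by (auto simp: h_def field_simps)
    define x where "x = (\<lambda>i :: nat. A + real i * h)"
    have x_n: "x n = B" using \<open>n > 0\<close> by (simp add: x_def h_def)
    have x_Suc: "x (Suc i) = x i + h" for i by (simp add: x_def algebra_simps)
    have x_mono: "x i \<le> x j" if "i \<le> j" for i j using that h by (simp add: x_def mult_right_mono)
    have x_in: "x i \<in> {A..B}" if "i \<le> n" for i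
      using x_mono[OF that] x_mono[of 0 i] by (simp add: x_n) (simp add: x_def)
    define r where "r = (\<lambda>i. ramp (x i) (x (Suc i)))"
    have x_less: "x i < x (Suc i)" for i using h by (simp add: x_Suc)
    \<comment> \<open>The piecewise linear interpolant after summation by parts: the ramp on each
      grid cell carries the increment of \<open>g\<close> across it.\<close>
    define s where "s = (\<lambda>t. g B + (\<Sum>i<n. (g (x i) - g (x (Suc i))) * r i t))"
    have s_cont: "continuous_on UNIV s"
      unfolding s_def r_def by (intro continuous_intros continuous_on_ramp)
    have s_int: "integrable \<nu> s"
      unfolding s_def r_def by (intro Bochner_Integration.integrable_add
          Bochner_Integration.integrable_sum integrable_mult_right integrable_ramp) auto
    have close: "\<bar>s t - g t\<bar> \<le> e" if t: "t \<in> {A..B}" for t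
    proof -
      have "\<exists>j<n. x j \<le> t \<and> t \<le> x (Suc j)"
      proof -
        define j where "j = (LEAST j. t \<le> x (Suc j))"
        have ex: "t \<le> x (Suc (n - 1))" using t \<open>n > 0\<close> x_n by simp
        then have 1: "t \<le> x (Suc j)" unfolding j_def by (rule LeastI)
        have "j \<le> n - 1" unfolding j_def using ex by (rule Least_le)
        moreover have "x j \<le> t"
        proof (cases j)
          case 0
          then show ?thesis using t by (simp add: x_def)
        next
          case (Suc k)
          then have "\<not> t \<le> x (Suc k)" unfolding j_def by (intro not_less_Least) simp
          then show ?thesis using Suc by simp
        qed
        ultimately show ?thesis using 1 \<open>n > 0\<close> by (intro exI[of _ j]) auto
      qed
      then obtain j where j: "j < n" "x j \<le> t" "t \<le> x (Suc j)" by blast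
      let ?f = "\<lambda>i. (g (x i) - g (x (Suc i))) * r i t"
      have "(\<Sum>i<n. ?f i) = (\<Sum>i<Suc j. ?f i) + (\<Sum>i=Suc j..<n. ?f i)"
        unfolding lessThan_atLeast0 using j(1) by (intro sum.atLeastLessThan_concat[symmetric]) auto
      also have "(\<Sum>i<Suc j. ?f i) = ?f j"
      proof -
        have "r i t = 0" if "i < j" for i
          unfolding r_def using x_mono[of "Suc i" j] that j(2) by (intro ramp_eq_0 x_less) simp
        then show ?thesis by simp
      qed
      also have "(\<Sum>i=Suc j..<n. ?f i) = (\<Sum>i=Suc j..<n. - (g (x (Suc i)) - g (x i)))"
      proof (rule sum.cong)
        fix i assume "i \<in> {Suc j..<n}"
        then have "r i t = 1"
          unfolding r_def using x_mono[of "Suc j" i] j(3) by (intro ramp_eq_1 x_less) simp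
        then show "?f i = - (g (x (Suc i)) - g (x i))" by simp
      qed simp
      also have "\<dots> = g (x (Suc j)) - g B"
        unfolding sum_negf using sum_Suc_diff'[of "Suc j" n "\<lambda>i. g (x i)"] j(1) x_n by simp
      finally have "s t = g (x (Suc j)) + ?f j" by (simp add: s_def)
      \<comment> \<open>Ramps of earlier cells vanish at \<open>t\<close>, those of later cells
        equal 1 and telescope; thus \<open>s t\<close> is a convex combination of the two adjacent
        grid values.\<close>
      then have "s t - g t = r j t * (g (x j) - g t) + (1 - r j t) * (g (x (Suc j)) - g t)"
        by (simp add: algebra_simps)
      also have "\<bar>\<dots>\<bar> \<le> r j t * \<bar>g (x j) - g t\<bar> + (1 - r j t) * \<bar>g (x (Suc j)) - g t\<bar>"
        using ramp_bounds[of "x j" "x (Suc j)" t]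
        by (intro order_trans[OF abs_triangle_ineq]) (simp add: abs_mult r_def)
      also have "\<dots> \<le> r j t * e + (1 - r j t) * e"
      proof (intro add_mono mult_left_mono)
        show "\<bar>g (x j) - g t\<bar> \<le> e" "\<bar>g (x (Suc j)) - g t\<bar> \<le> e"
          using j h x_Suc[of j] by (intro near x_in t; simp)+
      qed (use ramp_bounds[of "x j" "x (Suc j)" t] in \<open>auto simp: r_def\<close>)
      finally show ?thesis by (simp add: algebra_simps)
    qed
    have 1: "\<bar>L s - L g\<bar> \<le> e"
      by (intro approx s_cont cont close) (auto simp: A_def B_def)
    have 2: "\<bar>(\<integral>t. s t \<partial>\<nu>) - (\<integral>t. g t \<partial>\<nu>)\<bar> \<le> e"
      using AE_close
      by (intro \<nu>.abs_integral_diff_le s_int integrable_continuous_bounded cont bdd, eventually_elim)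
         (intro close, auto simp: A_def B_def)
    have Ls: "L s = g B + (\<Sum>i<n. (g (x i) - g (x (Suc i))) * L (r i))"
      unfolding s_def r_def
      by (subst add) (auto intro!: continuous_intros continuous_on_ramp simp: const sum continuous_on_ramp)
    have \<nu>s: "(\<integral>t. s t \<partial>\<nu>) = g B + (\<Sum>i<n. (g (x i) - g (x (Suc i))) * (\<integral>t. r i t \<partial>\<nu>))"
      unfolding s_def r_def using \<nu>.prob_space
      by (simp add: integrable_ramp Bochner_Integration.integral_sum)
    have "\<bar>L s - (\<integral>t. s t \<partial>\<nu>)\<bar> = \<bar>\<Sum>i<n. (g (x i) - g (x (Suc i))) * (L (r i) - (\<integral>t. r i t \<partial>\<nu>))\<bar>"
      unfolding Ls \<nu>s by (simp add: sum_subtractf right_diff_distrib)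
    also have "\<dots> \<le> (\<Sum>i<n. e * (F (x (Suc i)) - F (x i)))"
    proof (rule order_trans[OF sum_abs], rule sum_mono)
      fix i assume i: "i \<in> {..<n}"
      have "\<bar>g (x i) - g (x (Suc i))\<bar> \<le> e"
        using i h by (intro near x_in) (auto simp: x_Suc)
      moreover have "\<bar>L (r i) - (\<integral>t. r i t \<partial>\<nu>)\<bar> \<le> F (x (Suc i)) - F (x i)"
        unfolding r_def by (rule ramp_diff_le[OF x_less])
      ultimately show "\<bar>(g (x i) - g (x (Suc i))) * (L (r i) - (\<integral>t. r i t \<partial>\<nu>))\<bar>
          \<le> e * (F (x (Suc i)) - F (x i))"
        unfolding abs_mult using e by (intro mult_mono) auto
    qed
    also have "\<dots> = e * (F (x n) - F (x 0))"
      unfolding sum_distrib_left[symmetric] using sum_lessThan_telescope[of "\<lambda>i. F (x i)" n] by simp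
    also have "\<dots> = e"
      using F_eq_1[of "x n"] F_eq_0[of "x 0"] by (simp add: x_n B_def) (simp add: x_def A_def)
    finally show ?thesis using 1 2 by linarith
  qed
  \<comment> \<open>With \<open>e\<close> a sixth of the discrepancy, the discrepancy is at most
    half of itself; hence it is 0.\<close>
  from this[of "\<bar>L g - (\<integral>t. g t \<partial>\<nu>)\<bar> / 6"] show ?thesis by fastforce
qed

text \<open>The test function vanishes exactly on \<open>[-M, M]\<close>, so \<open>L\<close>
  annihilates it. The sharp bound keeps sums of two such points inside the norm bound used for the
  square Hamiltonian.\<close>

lemma AE_abs_le: "AE x in \<nu>. \<bar>x\<bar> \<le> M"
proof -
  let ?g = "\<lambda>t :: real. min 1 (max 0 (\<bar>t\<bar> - M))"
  have cont: "continuous_on UNIV ?g" by (intro continuous_intros)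
  have bdd: "bounded (range ?g)" by (auto simp: bounded_iff intro!: exI[of _ 1])
  have "L ?g \<le> L (\<lambda>_. 0)" using cont by (intro mono) auto
  moreover have "0 \<le> L ?g" using cont by (intro nonneg) auto
  ultimately have "(\<integral>t. ?g t \<partial>\<nu>) = 0" using integral_eq[OF cont bdd] const[of 0] by simp
  then have "AE t in \<nu>. ?g t = 0"
    using integrable_continuous_bounded[OF cont bdd]
    by (subst (asm) integral_nonneg_eq_0_iff_AE) auto
  then show ?thesis by eventually_elim (auto simp: min_def max_def split: if_splits)
qed

end

section \<open>Powers of the Fibonacci Hamiltonians\<close>

lemma fib_hamiltonian_lattice_operator:
  "lattice_operator (fib_hamiltonian lam \<omega>) {1, - 1} (\<lambda>n. lam * fib_potential \<omega> n) \<bar>lam\<bar>"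
proof
  show "\<bar>lam * fib_potential \<omega> n\<bar> \<le> \<bar>lam\<bar>" for n
    using fib_potential_bounds[of \<omega> n] by (simp add: abs_mult mult_left_le)
qed (auto simp: fib_hamiltonian_apply)

interpretation fib: lattice_operator "fib_hamiltonian lam \<omega>" "{1, - 1}"
    "\<lambda>n. lam * fib_potential \<omega> n" "\<bar>lam\<bar>" for lam \<omega>
  by (rule fib_hamiltonian_lattice_operator)

lemma square_fib_hamiltonian_lattice_operator:
  "lattice_operator (square_fib_hamiltonian lam1 lam2 \<omega>1 \<omega>2) {(1, 0), (- 1, 0), (0, 1), (0, - 1)}
     (\<lambda>(m, n). lam1 * fib_potential \<omega>1 m + lam2 * fib_potential \<omega>2 n) (\<bar>lam1\<bar> + \<bar>lam2\<bar>)"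
proof
  fix i :: "int \<times> int"
  obtain m n where i: "i = (m, n)" by (cases i)
  have "\<bar>lam1 * fib_potential \<omega>1 m\<bar> \<le> \<bar>lam1\<bar>" "\<bar>lam2 * fib_potential \<omega>2 n\<bar> \<le> \<bar>lam2\<bar>"
    using fib_potential_bounds by (simp_all add: abs_mult mult_left_le)
  then show "\<bar>case i of (m, n) \<Rightarrow> lam1 * fib_potential \<omega>1 m + lam2 * fib_potential \<omega>2 n\<bar> \<le> \<bar>lam1\<bar> + \<bar>lam2\<bar>"
    unfolding i prod.case by linarith
qed (auto simp: square_fib_hamiltonian_apply insert_commute)

interpretation square_fib: lattice_operator "square_fib_hamiltonian lam1 lam2 \<omega>1 \<omega>2"
    "{(1, 0), (- 1, 0), (0, 1), (0, - 1)}"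
    "\<lambda>(m, n). lam1 * fib_potential \<omega>1 m + lam2 * fib_potential \<omega>2 n" "\<bar>lam1\<bar> + \<bar>lam2\<bar>"
  for lam1 lam2 \<omega>1 \<omega>2
  by (rule square_fib_hamiltonian_lattice_operator)

text \<open>The coordinates of \<open>H^k \<delta>\<close> at the origin: a weighted count of
  lattice paths in which pausing at \<open>n\<close> has weight
  \<open>lam * fib_potential \<omega> n\<close>. As a real recursion it makes measurability in the
  phase a plain induction.\<close>

primrec walk :: "real \<Rightarrow> real \<Rightarrow> nat \<Rightarrow> int \<Rightarrow> real" where
  "walk lam \<omega> 0 n = (if n = 0 then 1 else 0)"
| "walk lam \<omega> (Suc k) n = walk lam \<omega> k (n + 1) + walk lam \<omega> k (n - 1)
     + lam * fib_potential \<omega> n * walk lam \<omega> k n"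

lemma power_fib_hamiltonian_nth:
  "l2_nth (blinfun_power (fib_hamiltonian lam \<omega>) k (l2_delta 0)) n = of_real (walk lam \<omega> k n)"
  by (induction k arbitrary: n) (auto simp: l2_delta.rep_eq fib_hamiltonian_apply)

lemma fib_moment: "fib.moment lam \<omega> k = walk lam \<omega> k 0"
  by (simp add: fib.moment_def inner_l2_delta power_fib_hamiltonian_nth)

text \<open>Pascal's rule as a product rule: one more step is taken in the first factor or in the
  second.\<close>

lemma binomial_sum_Suc:
  fixes a b :: "nat \<Rightarrow> real"
  shows "(\<Sum>j\<le>Suc k. real (Suc k choose j) * (a j * b (Suc k - j)))
    = (\<Sum>j\<le>k. real (k choose j) * (a (Suc j) * b (k - j)))
      + (\<Sum>j\<le>k. real (k choose j) * (a j * b (Suc (k - j))))"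
proof -
  have "(\<Sum>j\<le>Suc k. real (Suc k choose j) * (a j * b (Suc k - j)))
    = a 0 * b (Suc k) + (\<Sum>j\<le>k. real (Suc k choose Suc j) * (a (Suc j) * b (k - j)))"
    by (subst sum.atMost_Suc_shift) simp
  also have "\<dots> = (\<Sum>j\<le>k. real (k choose j) * (a (Suc j) * b (k - j)))
      + (a 0 * b (Suc k) + (\<Sum>j\<le>k. real (k choose Suc j) * (a (Suc j) * b (k - j))))"
    by (simp add: distrib_right sum.distrib)
  also have "a 0 * b (Suc k) + (\<Sum>j\<le>k. real (k choose Suc j) * (a (Suc j) * b (k - j)))
      = (\<Sum>j\<le>Suc k. real (k choose j) * (a j * b (Suc k - j)))"
    by (subst sum.atMost_Suc_shift) simp
  \<comment> \<open>The top term drops out because \<open>k choose Suc k = 0\<close>.\<close>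
  also have "\<dots> = (\<Sum>j\<le>k. real (k choose j) * (a j * b (Suc (k - j))))"
    by (simp add: binomial_eq_0 Suc_diff_le)
  finally show ?thesis .
qed

definition square_walk :: "real \<Rightarrow> real \<Rightarrow> real \<Rightarrow> real \<Rightarrow> nat \<Rightarrow> int \<Rightarrow> int \<Rightarrow> real" where
  "square_walk lam1 lam2 \<omega>1 \<omega>2 k m n
   = (\<Sum>j\<le>k. real (k choose j) * (walk lam1 \<omega>1 j m * walk lam2 \<omega>2 (k - j) n))"

text \<open>The binomial sums obey the recursion of the square Hamiltonian, which identifies them
  with the coordinates of its powers applied to \<open>\<delta>\<close>.\<close>

lemma square_walk_Suc:
  "square_walk lam1 lam2 \<omega>1 \<omega>2 (Suc k) m n
   = square_walk lam1 lam2 \<omega>1 \<omega>2 k (m + 1) n + square_walk lam1 lam2 \<omega>1 \<omega>2 k (m - 1) n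
     + square_walk lam1 lam2 \<omega>1 \<omega>2 k m (n + 1) + square_walk lam1 lam2 \<omega>1 \<omega>2 k m (n - 1)
     + (lam1 * fib_potential \<omega>1 m + lam2 * fib_potential \<omega>2 n) * square_walk lam1 lam2 \<omega>1 \<omega>2 k m n"
  unfolding square_walk_def
    binomial_sum_Suc[of k "\<lambda>j. walk lam1 \<omega>1 j m" "\<lambda>j. walk lam2 \<omega>2 j n"]
  by (simp add: algebra_simps sum.distrib sum_distrib_left)

lemma power_square_fib_hamiltonian_nth:
  "l2_nth (blinfun_power (square_fib_hamiltonian lam1 lam2 \<omega>1 \<omega>2) k (l2_delta (0, 0))) (m, n)
   = of_real (square_walk lam1 lam2 \<omega>1 \<omega>2 k m n)"
proof (induction k arbitrary: m n)
  case 0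
  show ?case by (simp add: l2_delta.rep_eq square_walk_def)
next
  case (Suc k)
  show ?case by (simp add: square_fib_hamiltonian_apply Suc square_walk_Suc)
qed

lemma square_fib_moment:
  "square_fib.moment lam1 lam2 \<omega>1 \<omega>2 k = square_walk lam1 lam2 \<omega>1 \<omega>2 k 0 0"
  by (simp add: square_fib.moment_def inner_l2_delta zero_prod_def power_square_fib_hamiltonian_nth)

lemma borel_measurable_fib_potential [measurable]:
  "(\<lambda>\<omega>. fib_potential \<omega> n) \<in> borel_measurable borel"
  unfolding fib_potential_def frac_def by measurable

lemma borel_measurable_walk [measurable]: "(\<lambda>\<omega>. walk lam \<omega> k n) \<in> borel_measurable borel"
  by (induction k arbitrary: n) auto

lemma abs_walk_le: "\<bar>walk lam \<omega> k n\<bar> \<le> (2 + \<bar>lam\<bar>) ^ k"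
proof (induction k arbitrary: n)
  case (Suc k)
  have "\<bar>lam * fib_potential \<omega> n * walk lam \<omega> k n\<bar> \<le> \<bar>lam\<bar> * (2 + \<bar>lam\<bar>) ^ k"
    unfolding abs_mult using fib_potential_bounds[of \<omega> n]
    by (intro mult_mono Suc.IH mult_left_le) auto
  then show ?case
    using Suc.IH[of "n + 1"] Suc.IH[of "n - 1"] by (simp add: algebra_simps) linarith
qed simp

section \<open>Density of states measures\<close>

definition circle :: "real measure" where
  "circle = restrict_space lborel {0..<1}"

interpretation circle: prob_space circle
  by (rule prob_spaceI) (simp add: circle_def emeasure_restrict_space space_restrict_space)

lemma set_integral_circle:
  fixes f :: "real \<Rightarrow> 'b :: {banach, second_countable_topology}"
  shows "(LINT \<omega>:{0..<1}|lborel. f \<omega>) = (\<integral>\<omega>. f \<omega> \<partial>circle)"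
  unfolding circle_def set_lebesgue_integral_def by (rule integral_restrict_space[symmetric]) simp

lemma borel_measurable_circle: "f \<in> borel_measurable borel \<Longrightarrow> f \<in> borel_measurable circle"
  unfolding circle_def by (rule measurable_restrict_space1) simp

lemma integrable_walk: "integrable circle (\<lambda>\<omega>. walk lam \<omega> k n)"
  by (rule circle.integrable_const_bound[where B = "(2 + \<bar>lam\<bar>) ^ k"])
     (auto intro!: borel_measurable_circle simp: abs_walk_le)

lemma fib_form_approx:
  assumes "continuous_on UNIV g" "\<And>t. \<bar>t\<bar> \<le> 2 + \<bar>lam\<bar> \<Longrightarrow> \<bar>poly p t - g t\<bar> \<le> e"
  shows "\<bar>(\<Sum>k\<le>degree p. coeff p k * walk lam \<omega> k 0) - fib.form lam \<omega> g\<bar> \<le> e"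
  using fib.form_approx[OF assms(1), of lam p e \<omega>] assms(2) by (simp add: fib_moment)

lemma square_fib_form_approx:
  assumes "continuous_on UNIV g" "\<And>t. \<bar>t\<bar> \<le> 4 + (\<bar>lam1\<bar> + \<bar>lam2\<bar>) \<Longrightarrow> \<bar>poly p t - g t\<bar> \<le> e"
  shows "\<bar>(\<Sum>k\<le>degree p. coeff p k * square_walk lam1 lam2 \<omega>1 \<omega>2 k 0 0)
    - square_fib.form lam1 lam2 \<omega>1 \<omega>2 g\<bar> \<le> e"
  using square_fib.form_approx[OF assms(1), of lam1 lam2 p e \<omega>1 \<omega>2] assms(2)
  by (simp add: square_fib_moment)

text \<open>Polynomials turn \<open>form\<close> into a finite combination of walk counts, and these
  converge uniformly in the phase.\<close>

lemma integrable_fib_form: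
  assumes g: "continuous_on UNIV g"
  shows "integrable circle (\<lambda>\<omega>. fib.form lam \<omega> g)"
proof -
  obtain p where p: "\<And>n t. \<bar>t\<bar> \<le> 2 + \<bar>lam\<bar> \<Longrightarrow> \<bar>poly (p n) t - g t\<bar> \<le> 1 / real (Suc n)"
    using polynomial_approximants[OF g] by blast
  show ?thesis
    by (rule circle.integrable_uniform_limit[OF _ fib_form_approx[OF g p] inverse_Suc_tendsto_0])
       (auto intro!: integrable_walk)
qed

definition fib_functional :: "real \<Rightarrow> (real \<Rightarrow> real) \<Rightarrow> real" where
  "fib_functional lam g = (\<integral>\<omega>. fib.form lam \<omega> g \<partial>circle)"

interpretation dos: positive_functional "fib_functional lam" "2 + \<bar>lam\<bar>" for lam
proof
  fix f g :: "real \<Rightarrow> real" and c :: real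
  assume f: "continuous_on UNIV f"
  show "fib_functional lam (\<lambda>t. c * f t) = c * fib_functional lam f"
    unfolding fib_functional_def using f by (simp add: fib.form_scale integrable_fib_form)
  show "0 \<le> fib_functional lam f" if "\<And>t. \<bar>t\<bar> \<le> 2 + \<bar>lam\<bar> \<Longrightarrow> 0 \<le> f t"
    unfolding fib_functional_def using that by (intro Bochner_Integration.integral_nonneg fib.form_nonneg f) simp
  assume g: "continuous_on UNIV g"
  show "fib_functional lam (\<lambda>t. f t + g t) = fib_functional lam f + fib_functional lam g"
    unfolding fib_functional_def using f g by (simp add: fib.form_add integrable_fib_form)
next
  have "fib.form lam \<omega> (\<lambda>_. 1) = 1" for \<omega>
    using fib.form_polynomial[of "\<lambda>_. 1" lam "[:1:]" \<omega>] by (simp add: fib.moment_0)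
  then show "fib_functional lam (\<lambda>_. 1) = 1"
    by (simp add: fib_functional_def circle.prob_space)
qed simp

text \<open>The real and imaginary parts of the characteristic function are integrals of bounded
  continuous functions, so Levy's uniqueness theorem applies.\<close>

lemma real_distribution_eqI:
  assumes "real_distribution \<mu>" "real_distribution \<nu>"
    and eq: "\<And>g :: real \<Rightarrow> real. continuous_on UNIV g \<Longrightarrow> bounded (range g) \<Longrightarrow> (\<integral>x. g x \<partial>\<mu>) = (\<integral>x. g x \<partial>\<nu>)"
  shows "\<mu> = \<nu>"
proof (rule Levy_uniqueness[OF assms(1,2)], rule ext)
  fix t :: real
  have bdd: "bounded (range (\<lambda>x. cos (t * x)))" "bounded (range (\<lambda>x. sin (t * x)))"
    by (auto simp: bounded_iff intro!: exI[of _ 1])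
  have char: "char M t = Complex (\<integral>x. cos (t * x) \<partial>M) (\<integral>x. sin (t * x) \<partial>M)"
    if "real_distribution M" for M
  proof -
    interpret real_distribution M by fact
    have "integrable M (\<lambda>x. iexp (t * x))" by (rule integrable_iexp) simp_all
    then show ?thesis
      unfolding char_def by (simp add: complex_eq_iff Re_exp Im_exp flip: integral_Re integral_Im)
  qed
  show "char \<mu> t = char \<nu> t"
    unfolding char[OF assms(1)] char[OF assms(2)]
    by (simp add: eq bdd continuous_intros)
qed

lemma real_distributionI: "prob_space M \<Longrightarrow> sets M = sets borel \<Longrightarrow> real_distribution M"
  by (simp add: real_distribution_def real_distribution_axioms_def)

text \<open>\<open>I\<close> is arbitrary so that both density of states measures, with a single and
  an iterated phase integral, are resolved by one argument.\<close>

lemma the_measure_eq: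
  assumes \<nu>: "real_distribution \<nu>"
    and I: "\<And>g :: real \<Rightarrow> real. continuous_on UNIV g \<Longrightarrow> bounded (range g) \<Longrightarrow> complex_of_real (\<integral>x. g x \<partial>\<nu>) = I g"
  shows "(THE \<nu>. prob_space \<nu> \<and> sets \<nu> = sets borel \<and>
     (\<forall>g :: real \<Rightarrow> real. continuous_on UNIV g \<longrightarrow> bounded (range g) \<longrightarrow> complex_of_real (\<integral>x. g x \<partial>\<nu>) = I g)) = \<nu>"
proof (rule the_equality)
  interpret real_distribution \<nu> by (fact \<nu>)
  show "prob_space \<nu> \<and> sets \<nu> = sets borel \<and>
     (\<forall>g :: real \<Rightarrow> real. continuous_on UNIV g \<longrightarrow> bounded (range g) \<longrightarrow> complex_of_real (\<integral>x. g x \<partial>\<nu>) = I g)"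
    using I by (simp add: prob_space_axioms)
next
  fix \<mu> :: "real measure"
  assume *: "prob_space \<mu> \<and> sets \<mu> = sets borel \<and>
     (\<forall>g :: real \<Rightarrow> real. continuous_on UNIV g \<longrightarrow> bounded (range g) \<longrightarrow> complex_of_real (\<integral>x. g x \<partial>\<mu>) = I g)"
  show "\<mu> = \<nu>"
  proof (rule real_distribution_eqI[OF _ \<nu>])
    show "real_distribution \<mu>" using * by (simp add: real_distributionI)
    fix g :: "real \<Rightarrow> real"
    assume "continuous_on UNIV g" "bounded (range g)"
    then have "complex_of_real (\<integral>x. g x \<partial>\<mu>) = complex_of_real (\<integral>x. g x \<partial>\<nu>)" using * I by simp
    then show "(\<integral>x. g x \<partial>\<mu>) = (\<integral>x. g x \<partial>\<nu>)" by simp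
  qed
qed

lemma fib_dos_eq: "fib_dos lam = dos.\<nu> lam"
  unfolding fib_dos_def
proof (rule the_measure_eq)
  show "real_distribution (dos.\<nu> lam)" by unfold_locales
  fix g :: "real \<Rightarrow> real"
  assume g: "continuous_on UNIV g" "bounded (range g)"
  show "complex_of_real (\<integral>x. g x \<partial>dos.\<nu> lam) = (LINT \<omega>:{0..<1}|lborel.
      l2_cinner (l2_delta 0) (blinfun_apply (cont_calculus g (fib_hamiltonian lam \<omega>)) (l2_delta 0)))"
    unfolding dos.integral_eq[OF g] fib.cinner_cont_calculus[OF g(1)] set_integral_circle fib_functional_def
    by (rule integral_complex_of_real[symmetric])
qed

section \<open>Moments of the density of states measures\<close>

lemma real_distribution_fib_dos: "real_distribution (fib_dos lam)"
  unfolding fib_dos_eq by unfold_locales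

lemma AE_fib_dos_abs_le: "AE x in fib_dos lam. \<bar>x\<bar> \<le> 2 + \<bar>lam\<bar>"
  unfolding fib_dos_eq by (rule dos.AE_abs_le)

lemma integrable_power_fib_dos: "integrable (fib_dos lam) (\<lambda>x. x ^ k)"
proof -
  interpret real_distribution "fib_dos lam" by (rule real_distribution_fib_dos)
  show ?thesis
  proof (rule integrable_const_bound)
    show "AE x in fib_dos lam. norm (x ^ k) \<le> (2 + \<bar>lam\<bar>) ^ k"
      using AE_fib_dos_abs_le[of lam] by eventually_elim (simp add: power_abs power_mono)
  qed simp
qed

text \<open>Powers are unbounded and hence not admissible test functions. Clamping the argument to
  \<open>[-R, R]\<close> makes them so, and changes neither the integral nor the form, as both see
  only this interval.\<close>

lemma integral_power_fib_dos: "(\<integral>x. x ^ k \<partial>fib_dos lam) = (\<integral>\<omega>. walk lam \<omega> k 0 \<partial>circle)"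
proof -
  interpret real_distribution "fib_dos lam" by (rule real_distribution_fib_dos)
  define R where "R = 2 + \<bar>lam\<bar>"
  define g :: "real \<Rightarrow> real" where "g = (\<lambda>x. (max (- R) (min R x)) ^ k)"
  have g_eq: "g x = x ^ k" if "\<bar>x\<bar> \<le> R" for x
  proof -
    have "max (- R) (min R x) = x" using that by linarith
    then show ?thesis by (simp add: g_def)
  qed
  have cont: "continuous_on UNIV g" unfolding g_def by (intro continuous_intros)
  have bdd: "bounded (range g)"
    unfolding bounded_iff
  proof (intro exI ballI)
    fix y assume "y \<in> range g"
    then obtain x where "y = (max (- R) (min R x)) ^ k" by (auto simp: g_def)
    moreover have "\<bar>max (- R) (min R x)\<bar> \<le> R" unfolding R_def by linarith
    ultimately show "norm y \<le> R ^ k" by (simp add: power_abs power_mono)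
  qed
  have "(\<integral>x. x ^ k \<partial>fib_dos lam) = (\<integral>x. g x \<partial>fib_dos lam)"
  proof (rule integral_cong_AE)
    show "AE x in fib_dos lam. x ^ k = g x"
      using AE_fib_dos_abs_le[of lam] by eventually_elim (simp add: g_eq R_def)
  qed (auto intro!: measurable_finite_borel borel_measurable_continuous_onI cont)
  also have "\<dots> = (\<integral>\<omega>. fib.form lam \<omega> g \<partial>circle)"
    unfolding fib_dos_eq dos.integral_eq[OF cont bdd] fib_functional_def ..
  also have "\<dots> = (\<integral>\<omega>. walk lam \<omega> k 0 \<partial>circle)"
  proof (rule Bochner_Integration.integral_cong)
    fix \<omega>
    have "fib.form lam \<omega> g = (\<Sum>i\<le>degree (monom (1 :: real) k). coeff (monom 1 k) i * fib.moment lam \<omega> i)"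
      by (rule fib.form_polynomial[OF cont]) (simp add: g_eq R_def poly_monom)
    then show "fib.form lam \<omega> g = walk lam \<omega> k 0"
      by (simp add: degree_monom_eq fib_moment if_distrib[of "\<lambda>c. c * _"] cong: if_cong)
  qed simp
  finally show ?thesis .
qed

text \<open>Used with walk counts over the circle and with powers over the density of states
  measures. The value depends only on the single integrals, and these agree in the two
  cases.\<close>

lemma binomial_double_integral:
  fixes a :: "'a \<Rightarrow> nat \<Rightarrow> real" and b :: "'b \<Rightarrow> nat \<Rightarrow> real" and n :: nat and c :: "nat \<Rightarrow> real"
  assumes a: "\<And>j. integrable M (\<lambda>x. a x j)" and b: "\<And>j. integrable N (\<lambda>y. b y j)"
  defines "s \<equiv> \<lambda>x y. \<Sum>k\<le>n. c k * (\<Sum>j\<le>k. real (k choose j) * (a x j * b y (k - j)))"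
  shows "integrable N (s x)"
    and "integrable M (\<lambda>x. \<integral>y. s x y \<partial>N)"
    and "(\<integral>x. \<integral>y. s x y \<partial>N \<partial>M)
      = (\<Sum>k\<le>n. c k * (\<Sum>j\<le>k. real (k choose j) * ((\<integral>x. a x j \<partial>M) * (\<integral>y. b y (k - j) \<partial>N))))"
proof -
  show "integrable N (s x)"
    unfolding s_def by (intro Bochner_Integration.integrable_sum integrable_mult_right b)
  have inner: "(\<integral>y. s x y \<partial>N) = (\<Sum>k\<le>n. c k * (\<Sum>j\<le>k. real (k choose j) * (a x j * (\<integral>y. b y (k - j) \<partial>N))))" for x
    unfolding s_def by (simp add: b)
  show "integrable M (\<lambda>x. \<integral>y. s x y \<partial>N)"
    unfolding inner by (intro Bochner_Integration.integrable_sum integrable_mult_right integrable_mult_left a)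
  show "(\<integral>x. \<integral>y. s x y \<partial>N \<partial>M)
      = (\<Sum>k\<le>n. c k * (\<Sum>j\<le>k. real (k choose j) * ((\<integral>x. a x j \<partial>M) * (\<integral>y. b y (k - j) \<partial>N))))"
    unfolding inner by (simp add: a)
qed

text \<open>Both sides are limits of the same numbers: for a polynomial test function the two
  iterated integrals coincide by the moment identity, and the approximation error is uniform in the
  phases and almost everywhere on the line.\<close>

lemma convolution_integral_eq_square_fib_form:
  assumes g: "continuous_on UNIV g" and bdd: "bounded (range g)"
  shows "(\<integral>E. g E \<partial>convolution (fib_dos lam1) (fib_dos lam2))
    = (\<integral>\<omega>1. \<integral>\<omega>2. square_fib.form lam1 lam2 \<omega>1 \<omega>2 g \<partial>circle \<partial>circle)"
proof -
  interpret \<nu>1: real_distribution "fib_dos lam1" by (rule real_distribution_fib_dos)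
  interpret \<nu>2: real_distribution "fib_dos lam2" by (rule real_distribution_fib_dos)
  interpret P: pair_prob_space "fib_dos lam1" "fib_dos lam2" ..
  obtain B where B: "\<And>x. norm (g x) \<le> B" using bdd by (auto simp: bounded_iff)
  have g_meas [measurable]: "g \<in> borel_measurable borel" by (rule borel_measurable_continuous_onI[OF g])
  have int_pair: "integrable (fib_dos lam1 \<Otimes>\<^sub>M fib_dos lam2) (\<lambda>(x, y). g (x + y))"
    using B by (intro P.integrable_const_bound[of _ B]) auto
  have int_x: "integrable (fib_dos lam1) (\<lambda>x. \<integral>y. g (x + y) \<partial>fib_dos lam2)"
    using P.integrable_fst'[OF int_pair] by simp
  have int_y: "integrable (fib_dos lam2) (\<lambda>y. g (x + y))" for x
    using B by (intro \<nu>2.integrable_const_bound[of _ B]) auto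
  have conv: "(\<integral>E. g E \<partial>convolution (fib_dos lam1) (fib_dos lam2)) = (\<integral>x. \<integral>y. g (x + y) \<partial>fib_dos lam2 \<partial>fib_dos lam1)"
    unfolding convolution_def
    by (subst integral_distr) (use P.integral_fst'[OF int_pair] in \<open>auto simp: case_prod_unfold\<close>)
  obtain p where p: "\<And>n t. \<bar>t\<bar> \<le> 4 + (\<bar>lam1\<bar> + \<bar>lam2\<bar>) \<Longrightarrow> \<bar>poly (p n) t - g t\<bar> \<le> 1 / real (Suc n)"
    using polynomial_approximants[OF g] by blast
  define s where "s = (\<lambda>n \<omega>1 \<omega>2. \<Sum>k\<le>degree (p n). coeff (p n) k * square_walk lam1 lam2 \<omega>1 \<omega>2 k 0 0)"
  have s: "s n = (\<lambda>\<omega>1 \<omega>2. \<Sum>k\<le>degree (p n). coeff (p n) k *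
      (\<Sum>j\<le>k. real (k choose j) * (walk lam1 \<omega>1 j 0 * walk lam2 \<omega>2 (k - j) 0)))" for n
    unfolding s_def square_walk_def ..
  have pq: "poly (p n) (x + y) = (\<Sum>k\<le>degree (p n). coeff (p n) k *
      (\<Sum>j\<le>k. real (k choose j) * (x ^ j * y ^ (k - j))))" for n x y
    unfolding poly_altdef binomial_ring by (simp add: mult.assoc)
  have same: "(\<integral>\<omega>1. \<integral>\<omega>2. s n \<omega>1 \<omega>2 \<partial>circle \<partial>circle)
      = (\<integral>x. \<integral>y. poly (p n) (x + y) \<partial>fib_dos lam2 \<partial>fib_dos lam1)" for n
    unfolding s pq
      binomial_double_integral(3)[of circle "\<lambda>\<omega> j. walk lam1 \<omega> j 0" circle "\<lambda>\<omega> j. walk lam2 \<omega> j 0",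
        OF integrable_walk integrable_walk]
      binomial_double_integral(3)[of "fib_dos lam1" "\<lambda>x j. x ^ j" "fib_dos lam2" "\<lambda>x j. x ^ j",
        OF integrable_power_fib_dos integrable_power_fib_dos]
      integral_power_fib_dos ..
  have s_approx: "\<bar>s n \<omega>1 \<omega>2 - square_fib.form lam1 lam2 \<omega>1 \<omega>2 g\<bar> \<le> 1 / real (Suc n)" for n \<omega>1 \<omega>2
    unfolding s_def by (rule square_fib_form_approx[OF g p])
  have s_int: "integrable circle (s n \<omega>1)" "integrable circle (\<lambda>\<omega>1. \<integral>\<omega>2. s n \<omega>1 \<omega>2 \<partial>circle)" for n \<omega>1
    unfolding s
    by (rule binomial_double_integral(1)[where M = circle and a = "\<lambda>\<omega> j. walk lam1 \<omega> j 0"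
          and b = "\<lambda>\<omega> j. walk lam2 \<omega> j 0", OF integrable_walk integrable_walk]
        binomial_double_integral(2)[where a = "\<lambda>\<omega> j. walk lam1 \<omega> j 0"
          and b = "\<lambda>\<omega> j. walk lam2 \<omega> j 0", OF integrable_walk integrable_walk])+
  have form_int: "integrable circle (\<lambda>\<omega>2. square_fib.form lam1 lam2 \<omega>1 \<omega>2 g)" for \<omega>1
    by (rule circle.integrable_uniform_limit[OF s_int(1) s_approx inverse_Suc_tendsto_0])
  have inner_approx: "\<bar>(\<integral>\<omega>2. s n \<omega>1 \<omega>2 \<partial>circle) - (\<integral>\<omega>2. square_fib.form lam1 lam2 \<omega>1 \<omega>2 g \<partial>circle)\<bar>
      \<le> 1 / real (Suc n)" for n \<omega>1
    by (intro circle.abs_integral_diff_le s_int form_int AE_I2 s_approx)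
  \<comment> \<open>Measurability of the inner integral in \<open>\<omega>1\<close> comes from
    uniform approximation, so Fubini's theorem does not enter on the phase side.\<close>
  have "integrable circle (\<lambda>\<omega>1. \<integral>\<omega>2. square_fib.form lam1 lam2 \<omega>1 \<omega>2 g \<partial>circle)"
    by (rule circle.integrable_uniform_limit[OF s_int(2) inner_approx inverse_Suc_tendsto_0])
  then have "\<bar>(\<integral>\<omega>1. \<integral>\<omega>2. s n \<omega>1 \<omega>2 \<partial>circle \<partial>circle)
      - (\<integral>\<omega>1. \<integral>\<omega>2. square_fib.form lam1 lam2 \<omega>1 \<omega>2 g \<partial>circle \<partial>circle)\<bar> \<le> 1 / real (Suc n)" for n
    by (intro circle.abs_integral_diff_le s_int AE_I2 inner_approx)
  then have lim1: "(\<lambda>n. \<integral>\<omega>1. \<integral>\<omega>2. s n \<omega>1 \<omega>2 \<partial>circle \<partial>circle)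
      \<longlonglongrightarrow> (\<integral>\<omega>1. \<integral>\<omega>2. square_fib.form lam1 lam2 \<omega>1 \<omega>2 g \<partial>circle \<partial>circle)"
    by (rule tendsto_if_within_inverse_Suc)
  have "\<bar>(\<integral>x. \<integral>y. poly (p n) (x + y) \<partial>fib_dos lam2 \<partial>fib_dos lam1)
      - (\<integral>x. \<integral>y. g (x + y) \<partial>fib_dos lam2 \<partial>fib_dos lam1)\<bar> \<le> 1 / real (Suc n)" for n
  proof (rule \<nu>1.abs_integral_diff_le[OF _ int_x])
    show "integrable (fib_dos lam1) (\<lambda>x. \<integral>y. poly (p n) (x + y) \<partial>fib_dos lam2)"
      unfolding pq by (intro binomial_double_integral integrable_power_fib_dos)
    show "AE x in fib_dos lam1. \<bar>(\<integral>y. poly (p n) (x + y) \<partial>fib_dos lam2) - (\<integral>y. g (x + y) \<partial>fib_dos lam2)\<bar>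
        \<le> 1 / real (Suc n)"
      using AE_fib_dos_abs_le[of lam1]
    proof eventually_elim
      case (elim x)
      show ?case
      proof (rule \<nu>2.abs_integral_diff_le[OF _ int_y])
        show "integrable (fib_dos lam2) (\<lambda>y. poly (p n) (x + y))"
          unfolding pq by (intro binomial_double_integral(1)[where M = "fib_dos lam1"] integrable_power_fib_dos)
        show "AE y in fib_dos lam2. \<bar>poly (p n) (x + y) - g (x + y)\<bar> \<le> 1 / real (Suc n)"
          using AE_fib_dos_abs_le[of lam2]
        proof eventually_elim
          case (elim y)
          show ?case by (rule p) (use elim \<open>\<bar>x\<bar> \<le> 2 + \<bar>lam1\<bar>\<close> in linarith)
        qed
      qed
    qed
  qed
  then have lim2: "(\<lambda>n. \<integral>x. \<integral>y. poly (p n) (x + y) \<partial>fib_dos lam2 \<partial>fib_dos lam1)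
      \<longlonglongrightarrow> (\<integral>x. \<integral>y. g (x + y) \<partial>fib_dos lam2 \<partial>fib_dos lam1)"
    by (rule tendsto_if_within_inverse_Suc)
  show ?thesis
    unfolding conv using LIMSEQ_unique[OF lim2 lim1[unfolded same]] .
qed

theorem square_fib_dos_eq_convolution: "square_fib_dos lam1 lam2 = convolution (fib_dos lam1) (fib_dos lam2)"
  unfolding square_fib_dos_def
proof (rule the_measure_eq)
  interpret \<nu>1: real_distribution "fib_dos lam1" by (rule real_distribution_fib_dos)
  interpret \<nu>2: real_distribution "fib_dos lam2" by (rule real_distribution_fib_dos)
  interpret P: pair_prob_space "fib_dos lam1" "fib_dos lam2" ..
  show "real_distribution (convolution (fib_dos lam1) (fib_dos lam2))"
    unfolding convolution_def by (intro P.real_distribution_distr) simp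
  fix g :: "real \<Rightarrow> real"
  assume g: "continuous_on UNIV g" "bounded (range g)"
  show "complex_of_real (\<integral>x. g x \<partial>convolution (fib_dos lam1) (fib_dos lam2)) =
      (LINT \<omega>1:{0..<1}|lborel. LINT \<omega>2:{0..<1}|lborel. l2_cinner (l2_delta (0, 0))
        (blinfun_apply (cont_calculus g (square_fib_hamiltonian lam1 lam2 \<omega>1 \<omega>2)) (l2_delta (0, 0))))"
    unfolding convolution_integral_eq_square_fib_form[OF g] set_integral_circle
      square_fib.cinner_cont_calculus[OF g(1), unfolded zero_prod_def] integral_complex_of_real ..
qed

section \<open>Convolutions of exact-dimensional measures\<close>

text \<open>The null intervals with rational endpoints are countably many, and every ball contains a
  rational interval around its centre. Positive mass is what permits undoing the logarithm in the
  definition of the dimension.\<close>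

lemma (in real_distribution) AE_measure_ball_pos: "AE x in M. \<forall>\<epsilon>>0. 0 < measure M (ball x \<epsilon>)"
proof -
  have "AE x in M. \<forall>a b :: rat. measure M {real_of_rat a<..<real_of_rat b} = 0 \<longrightarrow>
      x \<notin> {real_of_rat a<..<real_of_rat b}"
    unfolding AE_all_countable
  proof (intro allI)
    fix a b :: rat
    show "AE x in M. measure M {real_of_rat a<..<real_of_rat b} = 0 \<longrightarrow>
      x \<notin> {real_of_rat a<..<real_of_rat b}"
    proof (cases "measure M {real_of_rat a<..<real_of_rat b} = 0")
      case True
      then have "{real_of_rat a<..<real_of_rat b} \<in> null_sets M"
        by (simp add: null_sets_def emeasure_eq_measure)
      then have "AE x in M. x \<notin> {real_of_rat a<..<real_of_rat b}" by (rule AE_not_in)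
      then show ?thesis by eventually_elim simp
    qed simp
  qed
  then show ?thesis
  proof eventually_elim
    case (elim x)
    show ?case
    proof (intro allI impI)
      fix \<epsilon> :: real assume "\<epsilon> > 0"
      then obtain a b where ab: "x - \<epsilon> < real_of_rat a" "real_of_rat a < x" "x < real_of_rat b" "real_of_rat b < x + \<epsilon>"
        using of_rat_dense[of "x - \<epsilon>" x] of_rat_dense[of x "x + \<epsilon>"] by auto
      then have "measure M {real_of_rat a<..<real_of_rat b} \<noteq> 0" using elim by auto
      then have "0 < measure M {real_of_rat a<..<real_of_rat b}" by (simp add: zero_less_measure_iff)
      also have "\<dots> \<le> measure M (ball x \<epsilon>)"
        using ab by (intro finite_measure_mono) (auto simp: ball_def dist_real_def)
      finally show "0 < measure M (ball x \<epsilon>)" .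
    qed
  qed
qed

text \<open>The radius threshold is uniform over the set, as is required for counting cells at a
  single scale.\<close>

definition regular_points :: "real measure \<Rightarrow> real \<Rightarrow> nat \<Rightarrow> real set" where
  "regular_points \<mu> s k = {x. \<forall>\<epsilon>. 0 < \<epsilon> \<and> \<epsilon> < 1 / real (Suc k) \<longrightarrow> \<epsilon> powr s \<le> measure \<mu> (ball x \<epsilon>)}"

lemma exact_dimensional_AE_regular:
  assumes \<mu>: "real_distribution \<mu>" and d: "exact_dimensional \<mu> d" "d < s"
  shows "AE x in \<mu>. \<exists>k. x \<in> regular_points \<mu> s k"
proof -
  interpret real_distribution \<mu> by (fact \<mu>)
  have "AE x in \<mu>. ((\<lambda>\<epsilon>. ln (measure \<mu> (ball x \<epsilon>)) / ln \<epsilon>) \<longlongrightarrow> d) (at_right 0)"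
    using d(1) by (simp add: exact_dimensional_def)
  then show ?thesis
    using AE_measure_ball_pos
  proof eventually_elim
    case (elim x)
    have "\<forall>\<^sub>F \<epsilon> in at_right 0. ln (measure \<mu> (ball x \<epsilon>)) / ln \<epsilon> < s"
      using elim(1) d(2) by (rule order_tendstoD(2))
    then obtain b where b: "b > 0" "\<And>\<epsilon>. 0 < \<epsilon> \<Longrightarrow> \<epsilon> < b \<Longrightarrow> ln (measure \<mu> (ball x \<epsilon>)) / ln \<epsilon> < s"
      unfolding eventually_at_right_field by auto
    obtain k where k: "1 / real (Suc k) < b"
      using reals_Archimedean[OF b(1)] by (auto simp: inverse_eq_divide)
    have "\<epsilon> powr s \<le> measure \<mu> (ball x \<epsilon>)" if \<epsilon>: "0 < \<epsilon>" "\<epsilon> < 1 / real (Suc k)" for \<epsilon>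
    proof -
      \<comment> \<open>Radii below 1 have negative logarithm, so an upper bound on the quotient
        becomes a lower bound on the mass.\<close>
      have "1 / real (Suc k) \<le> 1" by simp
      with \<epsilon> have "\<epsilon> < 1" by linarith
      then have "ln \<epsilon> < 0" using \<epsilon> by simp
      moreover have "ln (measure \<mu> (ball x \<epsilon>)) / ln \<epsilon> < s" using \<epsilon> k by (intro b) auto
      ultimately have "s * ln \<epsilon> < ln (measure \<mu> (ball x \<epsilon>))" by (simp add: neg_divide_less_eq)
      then have "exp (s * ln \<epsilon>) \<le> exp (ln (measure \<mu> (ball x \<epsilon>)))" by simp
      then show ?thesis using elim(2) \<epsilon> by (simp add: powr_def)
    qed
    then show ?case unfolding regular_points_def by blast
  qed
qed

section \<open>Grid cells and covers of sumsets\<close>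

definition cell :: "real \<Rightarrow> int \<Rightarrow> real set" where
  "cell \<epsilon> j = {real_of_int j * \<epsilon>..<(real_of_int j + 1) * \<epsilon>}"

lemma borel_cell: "cell \<epsilon> j \<in> sets borel"
  by (simp add: cell_def)

lemma mem_cell_iff: "\<epsilon> > 0 \<Longrightarrow> x \<in> cell \<epsilon> j \<longleftrightarrow> j = \<lfloor>x / \<epsilon>\<rfloor>"
  unfolding cell_def eq_commute[of j] floor_eq_iff by (simp add: pos_le_divide_eq pos_divide_less_eq)

text \<open>The ball around a point of a cell is contained in that cell and its two neighbours. Each
  of these three families of disjoint cells has total mass at most 1, hence the factor 3.\<close>

lemma (in real_distribution) card_cells_le:
  assumes \<epsilon>: "\<epsilon> > 0" and A: "\<And>x. x \<in> A \<Longrightarrow> \<epsilon> powr s \<le> measure M (ball x \<epsilon>)"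
  defines "J \<equiv> {j. A \<inter> cell \<epsilon> j \<noteq> {}}"
  shows "finite J \<and> real (card J) \<le> 3 * \<epsilon> powr (- s)"
proof -
  have cells: "(\<Sum>j\<in>G. measure M (cell \<epsilon> (j + c))) \<le> 1" if "finite G" for G c
  proof -
    have "(\<Sum>j\<in>G. measure M (cell \<epsilon> (j + c))) = measure M (\<Union>j\<in>G. cell \<epsilon> (j + c))"
      using that \<epsilon> by (intro finite_measure_finite_Union[symmetric])
        (auto simp: disjoint_family_on_def mem_cell_iff borel_cell image_subset_iff)
    then show ?thesis by simp
  qed
  have bound: "real (card G) \<le> 3 * \<epsilon> powr (- s)" if G: "finite G" "G \<subseteq> J" for G
  proof -
    have "\<epsilon> powr s \<le> measure M (cell \<epsilon> (j + -1)) + measure M (cell \<epsilon> (j + 0)) + measure M (cell \<epsilon> (j + 1))"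
      if "j \<in> J" for j
    proof -
      obtain x where x: "x \<in> A" "x \<in> cell \<epsilon> j" using \<open>j \<in> J\<close> by (auto simp: J_def)
      have "ball x \<epsilon> \<subseteq> cell \<epsilon> (j + -1) \<union> cell \<epsilon> (j + 0) \<union> cell \<epsilon> (j + 1)"
        using x(2) by (auto simp: cell_def dist_real_def algebra_simps abs_less_iff)
      then have "measure M (ball x \<epsilon>) \<le> measure M (cell \<epsilon> (j + -1) \<union> cell \<epsilon> (j + 0) \<union> cell \<epsilon> (j + 1))"
        by (intro finite_measure_mono) (auto simp: cell_def)
      also have "\<dots> \<le> measure M (cell \<epsilon> (j + -1) \<union> cell \<epsilon> (j + 0)) + measure M (cell \<epsilon> (j + 1))"
        by (rule measure_Un_le) (auto simp: cell_def)
      also have "measure M (cell \<epsilon> (j + -1) \<union> cell \<epsilon> (j + 0)) \<le> measure M (cell \<epsilon> (j + -1)) + measure M (cell \<epsilon> (j + 0))"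
        by (rule measure_Un_le) (auto simp: cell_def)
      finally show ?thesis using A[OF x(1)] by linarith
    qed
    then have "(\<Sum>j\<in>G. \<epsilon> powr s)
        \<le> (\<Sum>j\<in>G. measure M (cell \<epsilon> (j + -1)) + measure M (cell \<epsilon> (j + 0)) + measure M (cell \<epsilon> (j + 1)))"
      using G(2) by (intro sum_mono) auto
    also have "\<dots> \<le> 3"
      using cells[OF G(1), of "-1"] cells[OF G(1), of 0] cells[OF G(1), of 1] by (simp only: sum.distrib)
    finally have "real (card G) * \<epsilon> powr s \<le> 3" by simp
    then show ?thesis using \<epsilon> by (simp add: powr_minus field_simps)
  qed
  \<comment> \<open>A uniform bound on the finite subsets gives finiteness of \<open>J\<close>, and
    then applies to \<open>J\<close> itself.\<close>
  have "finite J \<and> card J \<le> nat \<lfloor>3 * \<epsilon> powr (- s)\<rfloor>"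
    by (rule finite_if_finite_subsets_card_bdd) (use bound in \<open>simp add: le_nat_floor\<close>)
  then show ?thesis using bound[of J] by blast
qed

text \<open>The sum of two cells lies in an interval of length \<open>2 * \<epsilon>\<close>, and 18
  is 3 * 3 * 2. The measurable \<open>U\<close> stands in for the sumset, whose measurability is not
  claimed.\<close>

lemma sumset_cover:
  assumes "real_distribution \<mu>" "real_distribution \<nu>" and \<epsilon>: "\<epsilon> > 0"
    and A: "\<And>x. x \<in> A \<Longrightarrow> \<epsilon> powr s \<le> measure \<mu> (ball x \<epsilon>)"
    and B: "\<And>x. x \<in> B \<Longrightarrow> \<epsilon> powr t \<le> measure \<nu> (ball x \<epsilon>)"
  obtains U where "U \<in> sets lborel" "\<And>x y. x \<in> A \<Longrightarrow> y \<in> B \<Longrightarrow> x + y \<in> U"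
    "emeasure lborel U \<le> ennreal (18 * \<epsilon> powr (1 - s - t))"
proof -
  define I where "I = {j. A \<inter> cell \<epsilon> j \<noteq> {}}"
  define J where "J = {j. B \<inter> cell \<epsilon> j \<noteq> {}}"
  have I: "finite I" "real (card I) \<le> 3 * \<epsilon> powr (- s)"
    unfolding I_def using real_distribution.card_cells_le[OF assms(1) \<epsilon> A] by auto
  have J: "finite J" "real (card J) \<le> 3 * \<epsilon> powr (- t)"
    unfolding J_def using real_distribution.card_cells_le[OF assms(2) \<epsilon> B] by auto
  define V where "V = (\<lambda>(i, j). {(real_of_int i + real_of_int j) * \<epsilon>..(real_of_int i + real_of_int j + 2) * \<epsilon>})"
  show thesis
  proof
    show "(\<Union>p\<in>I \<times> J. V p) \<in> sets lborel"
      using I J by (intro sets.finite_UN) (auto simp: V_def)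
    fix x y assume xy: "x \<in> A" "y \<in> B"
    define i j where "i = \<lfloor>x / \<epsilon>\<rfloor>" and "j = \<lfloor>y / \<epsilon>\<rfloor>"
    have ij: "x \<in> cell \<epsilon> i" "y \<in> cell \<epsilon> j" using \<epsilon> by (simp_all add: mem_cell_iff i_def j_def)
    then have "(i, j) \<in> I \<times> J" using xy by (auto simp: I_def J_def)
    moreover have "x + y \<in> V (i, j)" using ij by (auto simp: V_def cell_def algebra_simps)
    ultimately show "x + y \<in> (\<Union>p\<in>I \<times> J. V p)" by blast
  next
    have "emeasure lborel (\<Union>p\<in>I \<times> J. V p) \<le> (\<Sum>p\<in>I \<times> J. emeasure lborel (V p))"
      using I J by (intro emeasure_subadditive_finite) (auto simp: V_def)
    also have "\<dots> = (\<Sum>p\<in>I \<times> J. ennreal (2 * \<epsilon>))"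
      by (rule sum.cong) (use \<epsilon> in \<open>auto simp: V_def algebra_simps\<close>)
    also have "\<dots> = ennreal (real (card I) * real (card J) * (2 * \<epsilon>))"
      using \<epsilon> by (simp add: card_cartesian_product ennreal_mult ennreal_of_nat_eq_real_of_nat)
    also have "\<dots> \<le> ennreal ((3 * \<epsilon> powr (- s)) * (3 * \<epsilon> powr (- t)) * (2 * \<epsilon>))"
      using \<epsilon> I J by (intro ennreal_leI mult_mono) auto
    also have "(3 * \<epsilon> powr (- s)) * (3 * \<epsilon> powr (- t)) * (2 * \<epsilon>) = 18 * (\<epsilon> powr (- s) * \<epsilon> powr (- t) * \<epsilon> powr 1)"
      using \<epsilon> by simp
    also have "\<epsilon> powr (- s) * \<epsilon> powr (- t) * \<epsilon> powr 1 = \<epsilon> powr (1 - s - t)"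
      unfolding powr_add[symmetric] by (simp add: algebra_simps)
    finally show "emeasure lborel (\<Union>p\<in>I \<times> J. V p) \<le> ennreal (18 * \<epsilon> powr (1 - s - t))" .
  qed
qed

lemma sumset_regular_points_null:
  assumes \<mu>\<nu>: "real_distribution \<mu>" "real_distribution \<nu>" and st: "s + t < 1"
  obtains N where "N \<in> null_sets lborel"
    "\<And>x y. x \<in> regular_points \<mu> s k \<Longrightarrow> y \<in> regular_points \<nu> t l \<Longrightarrow> x + y \<in> N"
proof -
  \<comment> \<open>The shift by \<open>k + l + 2\<close> puts every radius strictly below both
    thresholds, including the one at \<open>n = 0\<close>.\<close>
  define \<epsilon> where "\<epsilon> = (\<lambda>n. 1 / real (n + k + l + 2))"
  have \<epsilon>: "0 < \<epsilon> n" "\<epsilon> n < 1 / real (Suc k)" "\<epsilon> n < 1 / real (Suc l)" for n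
    by (auto simp: \<epsilon>_def intro!: divide_strict_left_mono)
  have "\<exists>U. U \<in> sets lborel \<and> (\<forall>x\<in>regular_points \<mu> s k. \<forall>y\<in>regular_points \<nu> t l. x + y \<in> U) \<and>
      emeasure lborel U \<le> ennreal (18 * \<epsilon> n powr (1 - s - t))" for n
  proof -
    have 1: "\<epsilon> n powr s \<le> measure \<mu> (ball x (\<epsilon> n))" if "x \<in> regular_points \<mu> s k" for x
      using that \<epsilon>[of n] by (simp add: regular_points_def)
    have 2: "\<epsilon> n powr t \<le> measure \<nu> (ball x (\<epsilon> n))" if "x \<in> regular_points \<nu> t l" for x
      using that \<epsilon>[of n] by (simp add: regular_points_def)
    show ?thesis
      using sumset_cover[OF \<mu>\<nu> \<epsilon>(1) 1 2] by metis
  qed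
  then obtain U where U: "\<And>n. U n \<in> sets lborel"
      "\<And>n x y. x \<in> regular_points \<mu> s k \<Longrightarrow> y \<in> regular_points \<nu> t l \<Longrightarrow> x + y \<in> U n"
      "\<And>n. emeasure lborel (U n) \<le> ennreal (18 * \<epsilon> n powr (1 - s - t))"
    by metis
  show thesis
  proof
    show "x + y \<in> (\<Inter>n. U n)" if "x \<in> regular_points \<mu> s k" "y \<in> regular_points \<nu> t l" for x y
      using U(2)[OF that] by blast
    have "\<epsilon> \<longlonglongrightarrow> 0"
      using LIMSEQ_ignore_initial_segment[OF lim_1_over_n, of "k + l + 2"]
      by (simp add: \<epsilon>_def add.assoc)
    then have "(\<lambda>n. 18 * \<epsilon> n powr (1 - s - t)) \<longlonglongrightarrow> 18 * 0"
      using st by (intro tendsto_mult tendsto_const tendsto_zero_powrI)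
        (auto intro: always_eventually less_imp_le \<epsilon>(1))
    then have lim: "(\<lambda>n. ennreal (18 * \<epsilon> n powr (1 - s - t))) \<longlonglongrightarrow> 0"
      using tendsto_ennrealI by fastforce
    have sets: "(\<Inter>n. U n) \<in> sets lborel" using U(1) by (intro sets.countable_INT) auto
    have "emeasure lborel (\<Inter>n. U n) \<le> ennreal (18 * \<epsilon> n powr (1 - s - t))" for n
      by (rule order_trans[OF emeasure_mono U(3)]) (use U(1) in auto)
    then have "emeasure lborel (\<Inter>n. U n) \<le> 0"
      by (intro LIMSEQ_le_const[OF lim]) auto
    then show "(\<Inter>n. U n) \<in> null_sets lborel"
      using sets by (intro null_setsI) auto
  qed
qed

theorem convolution_singular:
  assumes \<mu>\<nu>: "real_distribution \<mu>" "real_distribution \<nu>"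
    and dim: "exact_dimensional \<mu> d" "exact_dimensional \<nu> e" "d + e < 1"
  shows "\<exists>N\<in>null_sets lborel. emeasure (convolution \<mu> \<nu>) (UNIV - N) = 0"
proof -
  interpret \<mu>: real_distribution \<mu> by (fact \<mu>\<nu>)
  interpret \<nu>: real_distribution \<nu> by (fact \<mu>\<nu>)
  interpret P: pair_prob_space \<mu> \<nu> ..
  \<comment> \<open>The gap \<open>1 - d - e\<close> is split into thirds: one enlarges
    \<open>d\<close>, one enlarges \<open>e\<close>, and the last keeps \<open>s + t\<close> below
    1.\<close>
  define s t where "s = d + (1 - d - e) / 3" and "t = e + (1 - d - e) / 3"
  have st: "d < s" "e < t" "s + t < 1" using dim(3) by (auto simp: s_def t_def field_simps)
  have "\<exists>N. N \<in> null_sets lborel \<and> (\<forall>x\<in>regular_points \<mu> s k. \<forall>y\<in>regular_points \<nu> t l. x + y \<in> N)" for k l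
    using sumset_regular_points_null[OF \<mu>\<nu> st(3)] by metis
  then obtain N where N: "\<And>k l. N k l \<in> null_sets lborel"
      "\<And>k l x y. x \<in> regular_points \<mu> s k \<Longrightarrow> y \<in> regular_points \<nu> t l \<Longrightarrow> x + y \<in> N k l"
    by metis
  define Z where "Z = (\<Union>k. \<Union>l. N k l)"
  have Z: "Z \<in> null_sets lborel" unfolding Z_def using N(1) by (intro null_sets_UN) auto
  then have Z_sets [measurable]: "Z \<in> sets borel" by auto
  \<comment> \<open>Measurability is asked of \<open>Z\<close>; the regular points enter only
    through almost-everywhere statements.\<close>
  have "AE p in \<mu> \<Otimes>\<^sub>M \<nu>. fst p + snd p \<in> Z"
  proof (rule P.AE_pair_measure)
    show "{p \<in> space (\<mu> \<Otimes>\<^sub>M \<nu>). fst p + snd p \<in> Z} \<in> sets (\<mu> \<Otimes>\<^sub>M \<nu>)" by measurable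
    show "AE x in \<mu>. AE y in \<nu>. fst (x, y) + snd (x, y) \<in> Z"
      using exact_dimensional_AE_regular[OF \<mu>\<nu>(1) dim(1) st(1)]
    proof eventually_elim
      case (elim x)
      show ?case
        using exact_dimensional_AE_regular[OF \<mu>\<nu>(2) dim(2) st(2)]
      proof eventually_elim
        case (elim y)
        then show ?case using \<open>\<exists>k. x \<in> regular_points \<mu> s k\<close> N(2) unfolding Z_def fst_conv snd_conv by blast
      qed
    qed
  qed
  then have "emeasure (\<mu> \<Otimes>\<^sub>M \<nu>) {p \<in> space (\<mu> \<Otimes>\<^sub>M \<nu>). \<not> fst p + snd p \<in> Z} = 0"
    by (subst (asm) AE_iff_measurable[OF _ refl]) measurable
  moreover have "emeasure (convolution \<mu> \<nu>) (UNIV - Z)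
      = emeasure (\<mu> \<Otimes>\<^sub>M \<nu>) {p \<in> space (\<mu> \<Otimes>\<^sub>M \<nu>). \<not> fst p + snd p \<in> Z}"
    unfolding convolution_def
    by (subst emeasure_distr) (auto intro!: arg_cong[where f = "emeasure _"])
  ultimately show ?thesis using Z by auto
qed

theorem theorem1p5:
  fixes lam1 lam2 d1 d2 :: real
  assumes "lam1 > 0" and "lam2 > 0"
    and "exact_dimensional (fib_dos lam1) d1"
    and "exact_dimensional (fib_dos lam2) d2"
    and "d1 + d2 < 1"
  shows "\<exists>N \<in> null_sets lborel. emeasure (square_fib_dos lam1 lam2) (UNIV - N) = 0"
  unfolding square_fib_dos_eq_convolution
  by (rule convolution_singular[OF real_distribution_fib_dos real_distribution_fib_dos assms(3-5)])

end
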